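(* Consider each of the following properties of factors of an infinite word: closed, palindromic, maximal palindromic, privileged, rich, trapezoidal, balanced. For each property $\mathcal{P}$ in this list, the following hold. (a) If $\mathbf{x}$ is a $k$-automatic sequence, then the characteristic sequence of those $n$ for which $\mathbf{x}$ has a factor of length $n$ with property $\mathcal{P}$ is $k$-automatic. (b) If $\mathbf{x}$ is a $k$-automatic sequence, then the sequence counting, for each $n$, the number of (distinct) factors of $\mathbf{x}$ of length $n$ with property $\mathcal{P}$ is $k$-regular. (c) It is decidable, given a $k$-automatic sequence, whether it contains arbitrarily long factors with property $\mathcal{P}$. (d) There exists a function $g(k,\ell,n)$ such that if a $k$-automatic sequence $\mathbf{w}$ taking values over an alphabet of size $\ell$, generated by an $n$-state automaton, has at least one factor with property $\mathcal{P}$, then it has such a factor of length $\le g(k,\ell,n)$. The function $g$ does not depend on $\mathbf{w}$. (e) There exists a function $h(k,\ell,n)$ such that if a $k$-automatic sequence $\mathbf{w}$ taking values over an alphabet of size $\ell$, generated by an $n$-state automaton, has a factor with property $\mathcal{P}$ of length $\ge h(k,\ell,n)$, then it has arbitrarily large factors with property $\mathcal{P}$. The function $h$ does not depend on $\mathbf{w}$.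
   Context: Here $k\ge 2$ is an integer. A sequence $\mathbf{x}=x_0x_1x_2\cdots$ over a finite alphabet is $k$-automatic if there is a deterministic finite automaton with output (DFAO) that, on reading the base-$k$ representation of $n$, outputs $x_n$; the DFAO is said to generate $\mathbf{x}$, and a $k$-automatic sequence is "given" by specifying such a DFAO. A sequence $(f(n))_{n\ge0}$ is $k$-regular if it has a linear representation: there are a row vector $v$, a column vector $w$, and a matrix-valued morphism $\mu$ on $\{0,\ldots,k-1\}^*$ such that $f(n)=v\mu(u)w$ for every base-$k$ representation $u$ of $n$. Definitions for finite words. $|x|_w$ is the number of (possibly overlapping) occurrences of $w$ as a factor of $x$, and $x^R$ is the reversal of $x$. The empty word is a factor of every word. A nonempty word $w$ is a border of $x$ if $w$ is both a prefix and a suffix of $x$. - Palindrome: $x=x^R$. - Maximal palindrome of an infinite word $\mathbf{w}$: a factor $x$ of $\mathbf{w}$ that is a palindrome, such that no word of the form $axa$ with $a$ a single letter is a factor of $\mathbf{w}$. - Rich: $x$ has exactly $|x|+1$ distinct palindromic factors (including the empty word). - Closed: $|x|\le 1$, or $x$ has a border $w$ with $|x|_w=2$. - Privileged (recursive): $|x|\le 1$, or $x$ has a border $w$ with $|x|_w=2$ that is itself privileged. - Trapezoidal: for each $m\ge 0$, $x$ has at most $m+1$ distinct factors of length $m$. - Balanced: for all factors $y,z$ of $x$ of the same length and all letters $a$, $\bigl||y|_a-|z|_a\bigr|\le 1$. *)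

theory Defs
  imports "HOL-Library.Sublist" "HOL-Library.Nat_Bijection" "Jordan_Normal_Form.Matrix"
begin

section \<open>Properties of finite words\<close>

definition palindrome :: "'a list \<Rightarrow> bool" where
  "palindrome x \<longleftrightarrow> rev x = x"

text \<open>Occurrences are counted with overlaps; an occurrence is identified by what precedes it.\<close>

definition occurrences :: "'a list \<Rightarrow> 'a list \<Rightarrow> nat" where
  "occurrences x w = card {p. \<exists>s. x = p @ w @ s}"

definition border :: "'a list \<Rightarrow> 'a list \<Rightarrow> bool" where
  "border w x \<longleftrightarrow> w \<noteq> [] \<and> prefix w x \<and> suffix w x"

definition closed_word :: "'a list \<Rightarrow> bool" where
  "closed_word x \<longleftrightarrow> length x \<le> 1 \<or> (\<exists>w. border w x \<and> occurrences x w = 2)"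

text \<open>
  A border \<open>w\<close> of \<open>x\<close> that occurs twice in \<open>x\<close> is shorter than \<open>x\<close>, so the inductive
  predicate is the one given by recursion on the length.
\<close>

inductive privileged :: "'a list \<Rightarrow> bool" where
  "length x \<le> 1 \<Longrightarrow> privileged x"
| "border w x \<Longrightarrow> occurrences x w = 2 \<Longrightarrow> privileged w \<Longrightarrow> privileged x"

definition rich :: "'a list \<Rightarrow> bool" where
  "rich x \<longleftrightarrow> card {w. sublist w x \<and> palindrome w} = length x + 1"

definition trapezoidal :: "'a list \<Rightarrow> bool" where
  "trapezoidal x \<longleftrightarrow> (\<forall>m. card {w. sublist w x \<and> length w = m} \<le> m + 1)"

definition balanced :: "'a list \<Rightarrow> bool" where
  "balanced x \<longleftrightarrow> (\<forall>y z a. sublist y x \<and> sublist z x \<and> length y = length z \<longrightarrow>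
     \<bar>int (occurrences y [a]) - int (occurrences z [a])\<bar> \<le> 1)"

section \<open>Factors of infinite words\<close>

definition is_factor :: "'a list \<Rightarrow> (nat \<Rightarrow> 'a) \<Rightarrow> bool" where
  "is_factor w x \<longleftrightarrow> (\<exists>i j. w = map x [i..<j])"

definition maximal_palindrome :: "(nat \<Rightarrow> 'a) \<Rightarrow> 'a list \<Rightarrow> bool" where
  "maximal_palindrome x w \<longleftrightarrow>
     is_factor w x \<and> palindrome w \<and> (\<forall>a. \<not> is_factor ([a] @ w @ [a]) x)"

text \<open>
  A property of factors may depend on the infinite word in which the factor occurs, as
  \<^const>\<open>maximal_palindrome\<close> does.
\<close>

definition factors_with :: "((nat \<Rightarrow> 'a) \<Rightarrow> 'a list \<Rightarrow> bool) \<Rightarrow> (nat \<Rightarrow> 'a) \<Rightarrow> 'a list set" where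
  "factors_with P x = {w. is_factor w x \<and> P x w}"

definition arbitrarily_long :: "'a list set \<Rightarrow> bool" where
  "arbitrarily_long W \<longleftrightarrow> (\<forall>N. \<exists>w\<in>W. length w \<ge> N)"

section \<open>Automatic and regular sequences\<close>

text \<open>
  The canonical base-\<open>k\<close> representation, most significant digit first and without leading
  zeros; that of 0 is the empty word. The guard on \<open>k\<close> only ensures termination.
\<close>

fun canonical_rep :: "nat \<Rightarrow> nat \<Rightarrow> nat list" where
  "canonical_rep k n =
     (if k < 2 \<or> n = 0 then [] else canonical_rep k (n div k) @ [n mod k])"

declare canonical_rep.simps [simp del]

text \<open>Arbitrary base-\<open>k\<close> representations, most significant digit first, with leading zeros allowed.\<close>

definition is_rep :: "nat \<Rightarrow> nat list \<Rightarrow> nat \<Rightarrow> bool" where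
  "is_rep k u n \<longleftrightarrow> set u \<subseteq> {..<k} \<and> horner_sum id k (rev u) = n"

text \<open>
  The states are \<open>0, \<dots>, num_states - 1\<close>; the values of \<open>trans\<close> and \<open>out\<close> on other states
  and of \<open>trans\<close> on non-digits are irrelevant.
\<close>

record 'a dfao =
  num_states :: nat
  init :: nat
  trans :: "nat \<Rightarrow> nat \<Rightarrow> nat"
  out :: "nat \<Rightarrow> 'a"

definition is_dfao :: "nat \<Rightarrow> 'a dfao \<Rightarrow> bool" where
  "is_dfao k M \<longleftrightarrow> init M < num_states M \<and>
     (\<forall>q < num_states M. \<forall>d < k. trans M q d < num_states M)"

definition dfao_seq :: "nat \<Rightarrow> 'a dfao \<Rightarrow> nat \<Rightarrow> 'a" where
  "dfao_seq k M n = out M (foldl (trans M) (init M) (canonical_rep k n))"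

definition automatic :: "nat \<Rightarrow> (nat \<Rightarrow> 'a) \<Rightarrow> bool" where
  "automatic k x \<longleftrightarrow> (\<exists>M. is_dfao k M \<and> x = dfao_seq k M)"

definition word_mat :: "nat \<Rightarrow> (nat \<Rightarrow> 'a::semiring_1 mat) \<Rightarrow> nat list \<Rightarrow> 'a mat" where
  "word_mat r \<mu> u = foldr (\<lambda>d A. \<mu> d * A) u (1\<^sub>m r)"

definition regular :: "nat \<Rightarrow> (nat \<Rightarrow> int) \<Rightarrow> bool" where
  "regular k f \<longleftrightarrow> (\<exists>r v w. \<exists>\<mu> :: nat \<Rightarrow> int mat.
     v \<in> carrier_vec r \<and> w \<in> carrier_vec r \<and> (\<forall>d < k. \<mu> d \<in> carrier_mat r r) \<and>
     (\<forall>n u. is_rep k u n \<longrightarrow> f n = v \<bullet> (word_mat r \<mu> u *\<^sub>v w)))"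

section \<open>Decidability\<close>

text \<open>
  The total \<open>\<mu>\<close>-recursive functions of a given arity; the values on argument lists of any
  other length are irrelevant. Minimization is restricted to regular functions, i.e. those
  for which it always succeeds.
\<close>

inductive recursive :: "nat \<Rightarrow> (nat list \<Rightarrow> nat) \<Rightarrow> bool" where
  zero: "recursive n (\<lambda>_. 0)"
| succ: "recursive 1 (\<lambda>xs. Suc (hd xs))"
| proj: "i < n \<Longrightarrow> recursive n (\<lambda>xs. xs ! i)"
| comp: "recursive (length gs) f \<Longrightarrow> \<forall>g\<in>set gs. recursive n g \<Longrightarrow>
    recursive n (\<lambda>xs. f (map (\<lambda>g. g xs) gs))"
| prim_rec: "recursive n f \<Longrightarrow> recursive (n + 2) g \<Longrightarrow>
    recursive (Suc n) (\<lambda>xs. rec_nat (f (tl xs)) (\<lambda>y z. g (y # z # tl xs)) (hd xs))"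
| minimize: "recursive (Suc n) f \<Longrightarrow> \<forall>xs. length xs = n \<longrightarrow> (\<exists>y. f (y # xs) = 0) \<Longrightarrow>
    recursive n (\<lambda>xs. LEAST y. f (y # xs) = 0)"

text \<open>Decidability of \<open>yes\<close> on the instances \<open>inst\<close>, which are presented by their codes.\<close>

definition decidable :: "('i \<Rightarrow> nat) \<Rightarrow> 'i set \<Rightarrow> ('i \<Rightarrow> bool) \<Rightarrow> bool" where
  "decidable code inst yes \<longleftrightarrow>
     (\<exists>f. recursive 1 f \<and> (\<forall>p\<in>inst. f [code p] = (if yes p then 1 else 0)))"

definition dfao_code :: "nat \<Rightarrow> nat dfao \<Rightarrow> nat" where
  "dfao_code k M = list_encode
     [num_states M,
      init M,
      list_encode (map (\<lambda>q. list_encode (map (trans M q) [0..<k])) [0..<num_states M]),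
      list_encode (map (out M) [0..<num_states M])]"

end

theory Submission imports Defs begin

text \<open>
  The positions and lengths of the factors with each of the properties are first-order definable
  from addition and the automatic sequence. Instead of automata we count residuals: the residual
  of a relation at a tuple \<open>a\<close> records, for all \<open>m\<close>, which tuples of numbers below \<open>k ^ m\<close> may be
  appended digitwise to \<open>a\<close> in base \<open>k\<close>. Relations with finitely many residuals are closed under
  the logical operations: a quantifier turns \<open>N\<close> residuals into at most \<open>2 ^ N\<close>, and a solvable
  existential formula with \<open>N\<close> residuals has a witness below \<open>k ^ (N + s)\<close>, where \<open>s\<close> is the sum of
  the parameters. As the number of residuals is bounded by a computable function of the number of
  states, this makes every formula decidable, uniformly in the DFAO. The residuals are the states of
  a DFAO for (a) and the coordinates of a linear representation for (b); (c) is the truth of a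
  sentence, and (d) and (e) bound the least and the largest element of a definable set of lengths.
\<close>

section \<open>Computable functions\<close>

text \<open>Two obstacles shape the proof. Several of the properties are defined by cardinalities,
  letter counts or recursion, which a first-order formula over positions cannot express directly;
  each is first turned into a condition on equalities between a fixed number of windows of the
  sequence. Secondly, decidability must be uniform in the DFAO, so finiteness of the number of
  residuals for each single sequence is not enough: a bound has to be computable from the number of
  states. With such a bound an unbounded quantifier becomes a bounded search, and the decision
  procedure constructs no automaton. Residuals are taken at numbers rather than at digit strings, so
  leading zeros and components with different numbers of digits need no padding conventions. The
  bound \<open>k ^ (N + s)\<close> comes from pumping: after the last \<open>s\<close> digits, which
  cover the parameters, are split off, the rest of the witness stands above zeros only, and it can
  be replaced by a number with at most \<open>N\<close> digits and the same residual.\<close>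

definition computable :: "nat \<Rightarrow> (nat list \<Rightarrow> nat) \<Rightarrow> bool" where
  "computable n F \<longleftrightarrow> (\<exists>g. recursive n g \<and> (\<forall>xs. length xs = n \<longrightarrow> F xs = g xs))"

text \<open>\<open>recursive\<close> is sensitive to the values of a function at lists of every
  length. Ignoring the lengths other than the arity lets functions be written in any convenient
  form.\<close>

lemma computable_cong:
  "(\<And>xs. length xs = n \<Longrightarrow> F xs = G xs) \<Longrightarrow> computable n F \<longleftrightarrow> computable n G"
  unfolding computable_def by simp

lemma computable_comp:
  assumes "computable (length gs) f" "\<forall>g\<in>set gs. computable n g"
  shows "computable n (\<lambda>xs. f (map (\<lambda>g. g xs) gs))"
proof -
  obtain f' where f': "recursive (length gs) f'" "\<And>xs. length xs = length gs \<Longrightarrow> f xs = f' xs"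
    using assms(1) unfolding computable_def by blast
  obtain h where h: "\<And>g. g \<in> set gs \<Longrightarrow> recursive n (h g)"
      "\<And>g xs. g \<in> set gs \<Longrightarrow> length xs = n \<Longrightarrow> g xs = h g xs"
    using assms(2) unfolding computable_def by metis
  have "recursive n (\<lambda>xs. f' (map (\<lambda>g. g xs) (map h gs)))"
    by (rule recursive.comp) (use f' h in auto)
  moreover have "f (map (\<lambda>g. g xs) gs) = f' (map (\<lambda>g. g xs) (map h gs))" if "length xs = n" for xs
  proof -
    have "map (\<lambda>g. g xs) gs = map (\<lambda>g. g xs) (map h gs)"
      using h(2) that by simp
    moreover have "f (map (\<lambda>g. g xs) gs) = f' (map (\<lambda>g. g xs) gs)"
      using f'(2) by simp
    ultimately show ?thesis
      by (simp only:)
  qed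
  ultimately show ?thesis
    unfolding computable_def by blast
qed

lemma computable_nth: "i < n \<Longrightarrow> computable n (\<lambda>xs. xs ! i)"
  unfolding computable_def using recursive.proj by blast

lemma computable_hd: "computable (Suc n) hd"
  using computable_cong[of "Suc n" hd "\<lambda>xs. xs ! 0"] computable_nth[of 0 "Suc n"]
  by (metis hd_conv_nth length_0_conv nat.simps(3) zero_less_Suc)

lemma computable_reindex:
  assumes "computable (length is) f" "set is \<subseteq> {..<n}"
  shows "computable n (\<lambda>xs. f (map (\<lambda>i. xs ! i) is))"
proof -
  have "computable n (\<lambda>xs. f (map (\<lambda>g. g xs) (map (\<lambda>i xs. xs ! i) is)))"
    by (rule computable_comp) (use assms computable_nth in auto)
  then show ?thesis
    by (simp add: o_def)
qed

lemma computable_tl: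
  assumes "computable n f"
  shows "computable (Suc n) (\<lambda>xs. f (tl xs))"
proof -
  have tl: "map (\<lambda>i. xs ! i) (map Suc [0..<n]) = tl xs" if "length xs = Suc n" for xs :: "nat list"
    by (rule nth_equalityI) (use that in \<open>auto simp: nth_tl\<close>)
  have "computable (Suc n) (\<lambda>xs. f (map (\<lambda>i. xs ! i) (map Suc [0..<n])))"
    by (rule computable_reindex) (use assms in auto)
  then show ?thesis
    by (rule computable_cong[THEN iffD1, rotated]) (simp only: tl)
qed

lemma computable_Suc:
  assumes "computable n f"
  shows "computable n (\<lambda>xs. Suc (f xs))"
proof -
  have "computable 1 (\<lambda>xs. Suc (hd xs))"
    unfolding computable_def using recursive.succ by blast
  then show ?thesis
    using computable_comp[of "[f]" "\<lambda>xs. Suc (hd xs)" n] assms by simp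
qed

lemma computable_const: "computable n (\<lambda>_. c)"
proof (induction c)
  case 0
  then show ?case
    unfolding computable_def using recursive.zero by blast
next
  case (Suc c)
  then show ?case
    by (rule computable_Suc)
qed

text \<open>\<open>prim_rec\<close> recurses on the first argument; composing it with
  \<open>h\<close> and all projections gives recursion up to any computable bound, with a step that
  sees counter, accumulator and parameters.\<close>

lemma computable_rec:
  assumes f: "computable n f" and h: "computable n h"
    and g: "computable (Suc (Suc n)) (\<lambda>ys. g (hd ys) (hd (tl ys)) (tl (tl ys)))"
  shows "computable n (\<lambda>xs. rec_nat (f xs) (\<lambda>y z. g y z xs) (h xs))"
proof -
  obtain f' where f': "recursive n f'" "\<And>xs. length xs = n \<Longrightarrow> f xs = f' xs"
    using f unfolding computable_def by blast
  obtain g' where g': "recursive (n + 2) g'"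
    "\<And>y z xs. length xs = n \<Longrightarrow> g y z xs = g' (y # z # xs)"
    using g unfolding computable_def
    by (metis (no_types, lifting) add_2_eq_Suc' length_Cons list.sel(1,3))
  have "recursive (Suc n) (\<lambda>xs. rec_nat (f' (tl xs)) (\<lambda>y z. g' (y # z # tl xs)) (hd xs))"
    by (rule recursive.prim_rec) (use f' g' in auto)
  then have "computable (Suc n) (\<lambda>xs. rec_nat (f' (tl xs)) (\<lambda>y z. g' (y # z # tl xs)) (hd xs))"
    unfolding computable_def by blast
  from computable_comp[of "h # map (\<lambda>i xs. xs ! i) [0..<n]", simplified, OF this] h
  have "computable n (\<lambda>xs. rec_nat (f' (map ((!) xs) [0..<n]))
     (\<lambda>y z. g' (y # z # map ((!) xs) [0..<n])) (h xs))"
    by (auto simp: o_def computable_nth)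
  then show ?thesis
  proof (rule computable_cong[THEN iffD1, rotated])
    fix xs :: "nat list" assume "length xs = n"
    then have "map ((!) xs) [0..<n] = xs" "f' xs = f xs" "(\<lambda>y z. g' (y # z # xs)) = (\<lambda>y z. g y z xs)"
      using map_nth[of xs] f'(2) g'(2) by auto
    then show "rec_nat (f' (map ((!) xs) [0..<n])) (\<lambda>y z. g' (y # z # map ((!) xs) [0..<n])) (h xs)
        = rec_nat (f xs) (\<lambda>y z. g y z xs) (h xs)"
      by (simp only:)
  qed
qed

section \<open>Arithmetic\<close>

lemma computable_add:
  assumes "computable n f" "computable n g"
  shows "computable n (\<lambda>xs. f xs + g xs)"
proof -
  have "computable n (\<lambda>xs. rec_nat (f xs) (\<lambda>y z. Suc z) (g xs))"
    by (intro computable_rec assms computable_Suc computable_tl computable_hd)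
  moreover have "rec_nat a (\<lambda>y z. Suc z) b = a + b" for a b :: nat
    by (induction b) auto
  ultimately show ?thesis
    by simp
qed

lemma computable_mult:
  assumes "computable n f" "computable n g"
  shows "computable n (\<lambda>xs. f xs * g xs)"
proof -
  have "computable n (\<lambda>xs. rec_nat 0 (\<lambda>y z. z + f xs) (g xs))"
    by (intro computable_rec assms computable_const computable_add computable_tl computable_hd)
  moreover have "rec_nat 0 (\<lambda>y z. z + a) b = a * b" for a b :: nat
    by (induction b) auto
  ultimately show ?thesis
    by simp
qed

lemma computable_power:
  assumes "computable n f" "computable n g"
  shows "computable n (\<lambda>xs. f xs ^ g xs)"
proof -
  have "computable n (\<lambda>xs. rec_nat 1 (\<lambda>y z. z * f xs) (g xs))"
    by (intro computable_rec assms computable_const computable_mult computable_tl computable_hd)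
  moreover have "rec_nat 1 (\<lambda>y z. z * a) b = a ^ b" for a b :: nat
    by (induction b) auto
  ultimately show ?thesis
    by simp
qed

lemma computable_diff:
  assumes "computable n f" "computable n g"
  shows "computable n (\<lambda>xs. f xs - g xs)"
proof -
  have pred: "rec_nat 0 (\<lambda>y z. y) b = b - 1" for b :: nat
    by (induction b) auto
  have "computable n (\<lambda>xs. rec_nat (f xs) (\<lambda>y z. rec_nat 0 (\<lambda>y z. y) z) (g xs))"
    by (intro computable_rec assms computable_const computable_tl computable_hd)
  moreover have "rec_nat a (\<lambda>y z. z - 1) b = a - b" for a b :: nat
    by (induction b) auto
  ultimately show ?thesis
    by (simp add: pred)
qed

section \<open>Predicates, search and division\<close>

definition computable_pred :: "nat \<Rightarrow> (nat list \<Rightarrow> bool) \<Rightarrow> bool" where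
  "computable_pred n P \<longleftrightarrow> computable n (\<lambda>xs. of_bool (P xs))"

lemma computable_pred_not:
  assumes "computable_pred n P"
  shows "computable_pred n (\<lambda>xs. \<not> P xs)"
proof -
  have "computable n (\<lambda>xs. 1 - of_bool (P xs))"
    using assms unfolding computable_pred_def by (intro computable_diff computable_const)
  then show ?thesis
    unfolding computable_pred_def by (rule computable_cong[THEN iffD1, rotated]) auto
qed

lemma computable_pred_conj:
  assumes "computable_pred n P" "computable_pred n Q"
  shows "computable_pred n (\<lambda>xs. P xs \<and> Q xs)"
  using computable_mult[OF assms[unfolded computable_pred_def]]
  unfolding computable_pred_def by (simp add: of_bool_conj)

lemma computable_pred_disj:
  assumes "computable_pred n P" "computable_pred n Q"
  shows "computable_pred n (\<lambda>xs. P xs \<or> Q xs)"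
  using computable_pred_not[OF computable_pred_conj[OF assms[THEN computable_pred_not]]] by simp

lemma computable_pred_le:
  assumes "computable n f" "computable n g"
  shows "computable_pred n (\<lambda>xs. f xs \<le> g xs)"
proof -
  have "computable n (\<lambda>xs. 1 - (f xs - g xs))"
    by (intro computable_diff computable_const assms)
  then show ?thesis
    unfolding computable_pred_def by (rule computable_cong[THEN iffD1, rotated]) auto
qed

lemma computable_pred_eq:
  assumes "computable n f" "computable n g"
  shows "computable_pred n (\<lambda>xs. f xs = g xs)"
  using computable_pred_conj[OF computable_pred_le[OF assms] computable_pred_le[OF assms(2,1)]]
  by (simp add: order_eq_iff)

lemma computable_pred_less:
  assumes "computable n f" "computable n g"
  shows "computable_pred n (\<lambda>xs. f xs < g xs)"
  using computable_pred_not[OF computable_pred_le[OF assms(2,1)]] by (simp add: not_le)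

lemma computable_pred_bex:
  assumes P: "computable_pred (Suc n) (\<lambda>ys. P (hd ys) (tl ys))" and h: "computable n h"
  shows "computable_pred n (\<lambda>xs. \<exists>y<h xs. P y xs)"
proof -
  \<comment> \<open>The recursion step receives the counter, the accumulator and the parameters;
    \<open>P\<close> has to skip the accumulator at index 1.\<close>
  have "computable_pred (Suc (Suc n)) (\<lambda>ys. P (hd ys) (tl (tl ys)))"
  proof -
    let ?is = "0 # map (\<lambda>i. Suc (Suc i)) [0..<n]"
    have map_is: "map (\<lambda>i. ys ! i) ?is = hd ys # tl (tl ys)" if "length ys = Suc (Suc n)" for ys :: "nat list"
      using that by (auto intro!: nth_equalityI simp: nth_tl length_Suc_conv)
    have "computable (Suc (Suc n)) (\<lambda>xs. (\<lambda>ys. of_bool (P (hd ys) (tl ys))) (map (\<lambda>i. xs ! i) ?is))"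
      by (rule computable_reindex) (use P in \<open>auto simp: computable_pred_def\<close>)
    then show ?thesis
      unfolding computable_pred_def
      by (rule computable_cong[THEN iffD1, rotated]) (simp only: map_is list.sel)
  qed
  then have "computable_pred (Suc (Suc n)) (\<lambda>ys. 0 < hd (tl ys) \<or> P (hd ys) (tl (tl ys)))"
    by (intro computable_pred_disj computable_pred_less computable_const computable_tl computable_hd)
  then have "computable n (\<lambda>xs. rec_nat 0 (\<lambda>y z. of_bool (0 < z \<or> P y xs)) (h xs))"
    unfolding computable_pred_def by (intro computable_rec computable_const h)
  moreover have "rec_nat 0 (\<lambda>y z. of_bool (0 < z \<or> P y xs)) b = (of_bool (\<exists>y<b. P y xs) :: nat)" for b xs
    by (induction b) (auto simp: less_Suc_eq)
  ultimately show ?thesis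
    unfolding computable_pred_def by simp
qed

lemma computable_if:
  assumes "computable_pred n P" "computable n f" "computable n g"
  shows "computable n (\<lambda>xs. if P xs then f xs else g xs)"
proof -
  have "computable n (\<lambda>xs. of_bool (P xs) * f xs + of_bool (\<not> P xs) * g xs)"
    using assms computable_pred_not[OF assms(1)] unfolding computable_pred_def
    by (intro computable_add computable_mult)
  then show ?thesis
    by (rule computable_cong[THEN iffD1, rotated]) auto
qed

lemma computable_Least:
  assumes P: "computable_pred (Suc n) (\<lambda>ys. P (hd ys) (tl ys))"
    and ex: "\<And>xs. length xs = n \<Longrightarrow> \<exists>y. P y xs"
  shows "computable n (\<lambda>xs. LEAST y. P y xs)"
proof -
  \<comment> \<open>\<open>minimize\<close> searches for a zero, hence the negation.\<close>
  obtain f where f: "recursive (Suc n) f"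
      "\<And>xs. length xs = Suc n \<Longrightarrow> of_bool (\<not> P (hd xs) (tl xs)) = f xs"
    using computable_pred_not[OF P] unfolding computable_pred_def computable_def by blast
  then have f': "f (y # xs) = 0 \<longleftrightarrow> P y xs" if "length xs = n" for y xs
    using f(2)[of "y # xs"] that by (cases "P y xs") auto
  have "recursive n (\<lambda>xs. LEAST y. f (y # xs) = 0)"
    by (rule recursive.minimize) (use f f' ex in auto)
  then show ?thesis
    unfolding computable_def using f' by (intro exI[of _ "\<lambda>xs. LEAST y. f (y # xs) = 0"]) simp
qed

lemma computable_div:
  assumes "computable n f" "computable n g"
  shows "computable n (\<lambda>xs. f xs div g xs)"
proof -
  \<comment> \<open>The disjunct for a zero divisor makes the search total, and the value 0 that it
    then finds agrees with \<open>a div 0 = 0\<close>.\<close>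
  have ex: "g xs = 0 \<or> f xs < Suc (f xs) * g xs" for xs
    by (cases "g xs") auto
  have "computable n (\<lambda>xs. LEAST q. g xs = 0 \<or> f xs < Suc q * g xs)"
    by (rule computable_Least[of _ "\<lambda>q xs. g xs = 0 \<or> f xs < Suc q * g xs"])
      (intro computable_pred_disj computable_pred_eq computable_pred_less computable_mult
        computable_Suc computable_const computable_hd computable_tl assms, use ex in blast)
  moreover have "(LEAST q. b = 0 \<or> a < Suc q * b) = a div b" for a b :: nat
  proof (rule Least_equality)
    show "b = 0 \<or> a < Suc (a div b) * b"
      using dividend_less_times_div[of b a] by (auto simp: mult.commute)
    show "a div b \<le> q" if "b = 0 \<or> a < Suc q * b" for q
      using that less_mult_imp_div_less[of a "Suc q" b] by auto
  qed
  ultimately show ?thesis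
    by simp
qed

lemma computable_mod:
  assumes "computable n f" "computable n g"
  shows "computable n (\<lambda>xs. f xs mod g xs)"
proof -
  have "computable n (\<lambda>xs. f xs - f xs div g xs * g xs)"
    by (intro computable_diff computable_mult computable_div assms)
  then show ?thesis
    by (simp add: minus_div_mult_eq_mod)
qed

lemma computable_sum_list: "computable n sum_list"
proof (induction n)
  case 0
  have "computable 0 (\<lambda>_. 0)"
    by (rule computable_const)
  then show ?case
    by (rule computable_cong[THEN iffD1, rotated]) simp
next
  case (Suc n)
  have "computable (Suc n) (\<lambda>xs. hd xs + sum_list (tl xs))"
    by (intro computable_add computable_hd computable_tl Suc)
  then show ?case
    by (rule computable_cong[THEN iffD1, rotated]) (auto simp: length_Suc_conv)
qed

section \<open>Decoding pairs and lists\<close>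

lemma computable_triangle:
  assumes "computable n f"
  shows "computable n (\<lambda>xs. triangle (f xs))"
proof -
  have "computable n (\<lambda>xs. rec_nat 0 (\<lambda>y z. z + Suc y) (f xs))"
    by (intro computable_rec computable_const computable_add computable_Suc computable_tl
      computable_hd assms)
  moreover have "rec_nat 0 (\<lambda>y z. z + Suc y) b = triangle b" for b
    by (induction b) auto
  ultimately show ?thesis
    by simp
qed

text \<open>The pairing function is inverted by a search for a solution of its defining equation.
  Both components are at most the code, which bounds the inner quantifier.\<close>

lemma computable_prod_decode:
  assumes "computable n f"
  shows "computable n (\<lambda>xs. fst (prod_decode (f xs)))" "computable n (\<lambda>xs. snd (prod_decode (f xs)))"
proof -
  have 1: "prod_decode z = (a, b)" if "triangle (a + b) + a = z" for a b z
  proof -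
    have "prod_encode (a, b) = z"
      using that by (simp add: prod_encode_def)
    then show ?thesis
      by (metis prod_encode_inverse)
  qed
  have 2: "fst (prod_decode z) < Suc z \<and> snd (prod_decode z) < Suc z \<and>
      triangle (fst (prod_decode z) + snd (prod_decode z)) + fst (prod_decode z) = z" for z
  proof -
    obtain a b where ab: "prod_decode z = (a, b)"
      by fastforce
    then have "prod_encode (a, b) = z"
      by (metis prod_decode_inverse)
    then show ?thesis
      using le_prod_encode_1[of a b] le_prod_encode_2[of b a] ab by (simp add: prod_encode_def)
  qed
  then have ex: "\<exists>a<Suc z. \<exists>b<Suc z. triangle (a + b) + a = z" for z
    by blast
  have "computable n (\<lambda>xs. LEAST a. \<exists>b<Suc (f xs). triangle (a + b) + a = f xs)"
    by (rule computable_Least[of _ "\<lambda>a xs. \<exists>b<Suc (f xs). triangle (a + b) + a = f xs"])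
      (intro computable_pred_bex computable_pred_eq computable_add computable_triangle computable_hd
        computable_tl computable_Suc assms, use ex in blast)
  moreover have "(LEAST a. \<exists>b<Suc z. triangle (a + b) + a = z) = fst (prod_decode z)" for z
    by (rule Least_equality, use 2 in blast) (metis 1 fst_conv order_refl)
  ultimately show "computable n (\<lambda>xs. fst (prod_decode (f xs)))"
    by simp
  have "computable n (\<lambda>xs. LEAST b. \<exists>a<Suc (f xs). triangle (a + b) + a = f xs)"
    by (rule computable_Least[of _ "\<lambda>b xs. \<exists>a<Suc (f xs). triangle (a + b) + a = f xs"])
      (intro computable_pred_bex computable_pred_eq computable_add computable_triangle computable_hd
        computable_tl computable_Suc assms, use ex in blast)
  moreover have "(LEAST b. \<exists>a<Suc z. triangle (a + b) + a = z) = snd (prod_decode z)" for z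
    by (rule Least_equality, use 2 in blast) (metis 1 snd_conv order_refl)
  ultimately show "computable n (\<lambda>xs. snd (prod_decode (f xs)))"
    by simp
qed

text \<open>The code of a nonempty list is the successor of the pair of its head and its encoded
  tail, so every decoding is preceded by the subtraction of 1.\<close>

definition code_nth :: "nat \<Rightarrow> nat \<Rightarrow> nat" where
  "code_nth c i = fst (prod_decode (rec_nat c (\<lambda>_ z. snd (prod_decode (z - 1))) i - 1))"

lemma code_nth_list_encode:
  assumes "i < length xs"
  shows "code_nth (list_encode xs) i = xs ! i"
proof -
  have "rec_nat (list_encode xs) (\<lambda>_ z. snd (prod_decode (z - 1))) i = list_encode (drop i xs)"
    if "i < length xs" for i
    using that
  proof (induction i)
    case (Suc i)
    then show ?case
      by (simp flip: Cons_nth_drop_Suc[of i])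
  qed simp
  then show ?thesis
    unfolding code_nth_def using assms by (simp flip: Cons_nth_drop_Suc[of i])
qed

lemma computable_code_nth:
  assumes "computable n f" "computable n g"
  shows "computable n (\<lambda>xs. code_nth (f xs) (g xs))"
  unfolding code_nth_def
  by (intro computable_prod_decode computable_diff computable_rec computable_tl computable_hd
    computable_const assms)

section \<open>Residuals\<close>

text \<open>On \<open>A\<close> the function \<open>f\<close> factors through \<open>g\<close>.
  Applied with the residual as \<open>f\<close> and an invariant with few values as
  \<open>g\<close>.\<close>

lemma card_image_le_of_determined:
  assumes "finite (g ` A)" and det: "\<And>a a'. a \<in> A \<Longrightarrow> a' \<in> A \<Longrightarrow> g a = g a' \<Longrightarrow> f a = f a'"
  shows "finite (f ` A) \<and> card (f ` A) \<le> card (g ` A)"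
proof -
  have "f a = f (inv_into A g (g a))" if "a \<in> A" for a
    using det[OF that inv_into_into[OF imageI[OF that]]] f_inv_into_f[OF imageI[OF that]] by metis
  then have "f ` A = (\<lambda>y. f (inv_into A g y)) ` (g ` A)"
    unfolding image_image by (rule image_cong[OF refl])
  then show ?thesis
    using assms(1) card_image_le finite_imageI by metis
qed

locale numeration =
  fixes k :: nat
  assumes k_ge_2: "2 \<le> k"
begin

lemma k_pos [simp]: "0 < k" and k_power_pos [simp]: "0 < k ^ m"
  using k_ge_2 by auto

lemma less_k_power: "n < k ^ n"
  using k_ge_2 by (metis less_exp order_less_le_trans power_mono zero_le)

text \<open>Appending \<open>m\<close> digits, given as numbers below \<open>k ^ m\<close>, to all components of a tuple.\<close>

definition glue :: "nat \<Rightarrow> nat list \<Rightarrow> nat list \<Rightarrow> nat list" where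
  "glue m a b = map2 (\<lambda>x y. x * k ^ m + y) a b"

lemma length_glue [simp]: "length (glue m a b) = min (length a) (length b)"
  by (simp add: glue_def)

lemma nth_glue: "i < length a \<Longrightarrow> i < length b \<Longrightarrow> glue m a b ! i = a ! i * k ^ m + b ! i"
  by (simp add: glue_def)

lemma glue_Cons [simp]: "glue m (x # a) (y # b) = (x * k ^ m + y) # glue m a b"
  by (simp add: glue_def)

lemma glue_Nil [simp]: "glue m [] [] = []"
  by (simp add: glue_def)

lemma glue_zeros: "length b = d \<Longrightarrow> glue m (replicate d 0) b = b"
  by (rule nth_equalityI) (auto simp: nth_glue)

lemma glue_0: "length a = d \<Longrightarrow> glue 0 a (replicate d 0) = a"
  by (rule nth_equalityI) (auto simp: nth_glue)

lemma glue_glue: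
  "length b = length a \<Longrightarrow> length c = length a \<Longrightarrow>
   glue m (glue p a b) c = glue (m + p) a (glue m b c)"
  by (rule nth_equalityI) (auto simp: nth_glue power_add algebra_simps)

lemma append_digits_less: "x < k ^ p \<Longrightarrow> y < k ^ m \<Longrightarrow> x * k ^ m + y < k ^ (m + p)"
proof -
  assume *: "x < k ^ p" "y < k ^ m"
  then have "x * k ^ m + y < Suc x * k ^ m"
    by simp
  also have "\<dots> \<le> k ^ p * k ^ m"
    using * by (intro mult_right_mono) auto
  finally show ?thesis
    by (simp add: power_add mult.commute)
qed

lemma glue_less:
  assumes "set b \<subseteq> {..<k ^ p}" "set c \<subseteq> {..<k ^ m}"
  shows "set (glue m b c) \<subseteq> {..<k ^ (m + p)}"
proof -
  have "x * k ^ m + y < k ^ (m + p)" if "(x, y) \<in> set (zip b c)" for x y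
    using set_zip_leftD[OF that] set_zip_rightD[OF that] assms append_digits_less[of x p y m] by auto
  then show ?thesis
    by (auto simp: glue_def)
qed

text \<open>The Myhill-Nerode quotient of the set of digit strings of the tuples in
  \<open>R\<close>, read from the most significant digit. The length \<open>m\<close> is recorded
  because a number below \<open>k ^ m\<close> does not show how many leading zeros belong to the
  appended block.\<close>

definition residual :: "(nat list \<Rightarrow> bool) \<Rightarrow> nat list \<Rightarrow> (nat \<times> nat list) set" where
  "residual R a = {(m, b). length b = length a \<and> set b \<subseteq> {..<k ^ m} \<and> R (glue m a b)}"

lemma in_residual:
  "(m, b) \<in> residual R a \<longleftrightarrow> length b = length a \<and> set b \<subseteq> {..<k ^ m} \<and> R (glue m a b)"
  by (simp add: residual_def)

lemma residual_glue:
  assumes "length b = length a" "set b \<subseteq> {..<k ^ p}"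
  shows "(m, c) \<in> residual R (glue p a b) \<longleftrightarrow>
    length c = length a \<and> set c \<subseteq> {..<k ^ m} \<and> (m + p, glue m b c) \<in> residual R a"
  using assms glue_less[of b p c m] by (auto simp: in_residual glue_glue)

text \<open>The right invariance that makes reading digits a well-defined transition between
  residuals.\<close>

lemma residual_extend:
  assumes "residual R a = residual R a'" "length a = length a'"
    "length b = length a" "set b \<subseteq> {..<k ^ p}"
  shows "residual R (glue p a b) = residual R (glue p a' b)"
  using residual_glue[of b a p _ _ R] residual_glue[of b a' p _ _ R] assms by auto

lemma residual_self: "R a \<longleftrightarrow> (0, replicate (length a) 0) \<in> residual R a"
  by (auto simp: in_residual glue_0)

text \<open>Finiteness is demanded separately because \<open>card\<close> of an infinite set is
  0.\<close>

definition few_residuals :: "nat \<Rightarrow> nat \<Rightarrow> (nat list \<Rightarrow> bool) \<Rightarrow> bool" where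
  "few_residuals d N R \<longleftrightarrow>
     finite (residual R ` {a. length a = d}) \<and> card (residual R ` {a. length a = d}) \<le> N"

text \<open>It suffices to find an invariant \<open>g\<close> with few values that determines the
  residual. One inclusion is enough, as \<open>a\<close> and \<open>a'\<close> may be
  exchanged.\<close>

lemma few_residualsI:
  assumes "\<And>a. length a = d \<Longrightarrow> g a \<in> S" "finite S" "card S \<le> N"
    and "\<And>a a' m b. length a = d \<Longrightarrow> length a' = d \<Longrightarrow> g a = g a' \<Longrightarrow> (m, b) \<in> residual R a \<Longrightarrow>
      (m, b) \<in> residual R a'"
  shows "few_residuals d N R"
proof -
  have sub: "g ` {a. length a = d} \<subseteq> S"
    using assms(1) by auto
  have "finite (residual R ` {a. length a = d}) \<and>
      card (residual R ` {a. length a = d}) \<le> card (g ` {a. length a = d})"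
  proof (rule card_image_le_of_determined)
    show "finite (g ` {a. length a = d})"
      using sub assms(2) by (rule finite_subset)
    show "residual R a = residual R a'"
      if "a \<in> {a. length a = d}" "a' \<in> {a. length a = d}" "g a = g a'" for a a'
      using assms(4)[of a a'] assms(4)[of a' a] that by auto
  qed
  then show ?thesis
    unfolding few_residuals_def using card_mono[OF assms(2) sub] assms(3) by linarith
qed

lemma few_residuals_neg:
  assumes "few_residuals d N R"
  shows "few_residuals d N (\<lambda>e. \<not> R e)"
  by (rule few_residualsI[where g = "residual R" and S = "residual R ` {a. length a = d}"])
    (use assms in \<open>auto simp: few_residuals_def in_residual set_eq_iff\<close>)

lemma few_residuals_conj:
  assumes R: "few_residuals d N R" and Q: "few_residuals d N' Q"
  shows "few_residuals d (N * N') (\<lambda>e. R e \<and> Q e)"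
proof (rule few_residualsI[where g = "\<lambda>a. (residual R a, residual Q a)"])
  show "card (residual R ` {a. length a = d} \<times> residual Q ` {a. length a = d}) \<le> N * N'"
    using R Q unfolding few_residuals_def card_cartesian_product by (intro mult_mono) auto
qed (use R Q in \<open>auto simp: few_residuals_def in_residual set_eq_iff\<close>)

text \<open>A witness is split into its last \<open>m\<close> digits \<open>e\<close> and its
  leading part \<open>c\<close>, as in the subset construction. Since \<open>c\<close> ranges over
  all numbers, witnesses with more digits than the parameters need no separate treatment.\<close>

lemma residual_ex:
  "(m, b) \<in> residual (\<lambda>e. \<exists>y. R (y # e)) a \<longleftrightarrow>
   length b = length a \<and> set b \<subseteq> {..<k ^ m} \<and>
   (\<exists>s\<in>range (\<lambda>c. residual R (c # a)). \<exists>e. (m, e # b) \<in> s)"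
proof -
  have "(\<exists>y. R (y # glue m a b)) \<longleftrightarrow> (\<exists>c. \<exists>e<k ^ m. R ((c * k ^ m + e) # glue m a b))"
    by (metis div_mult_mod_eq k_power_pos mod_less_divisor)
  then show ?thesis
    by (auto simp: in_residual)
qed

lemma few_residuals_ex:
  assumes "few_residuals (Suc d) N R"
  shows "few_residuals d (2 ^ N) (\<lambda>e. \<exists>y. R (y # e))"
proof -
  let ?S = "residual R ` {a. length a = Suc d}"
  have S: "finite ?S" "card ?S \<le> N"
    using assms by (auto simp: few_residuals_def)
  show ?thesis
  proof (rule few_residualsI[where g = "\<lambda>a. range (\<lambda>c. residual R (c # a))"])
    show "range (\<lambda>c. residual R (c # a)) \<in> Pow ?S" if "length a = d" for a
      using that by auto
    show "finite (Pow ?S)" "card (Pow ?S) \<le> 2 ^ N"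
      using S by (auto simp: card_Pow)
  qed (simp only: residual_ex)
qed

lemma few_residuals_reindex:
  assumes R: "few_residuals (length js) N R" and js: "set js \<subseteq> {..<d}"
  shows "few_residuals d N (\<lambda>e. R (map (\<lambda>i. e ! i) js))"
proof (rule few_residualsI[where g = "\<lambda>a. residual R (map (\<lambda>i. a ! i) js)"
      and S = "residual R ` {a. length a = length js}"])
  fix a a' m b
  assume a: "length a = d" "length a' = d"
    and eq: "residual R (map ((!) a) js) = residual R (map ((!) a') js)"
    and b: "(m, b) \<in> residual (\<lambda>e. R (map ((!) e) js)) a"
  have *: "map ((!) (glue m a b)) js = glue m (map ((!) a) js) (map ((!) b) js)"
    if "length a = d" "length b = d" for a b
  proof (rule nth_equalityI)
    fix j assume "j < length (map ((!) (glue m a b)) js)"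
    then have "j < length js" "js ! j < d"
      using js by (auto dest: nth_mem)
    then show "map ((!) (glue m a b)) js ! j = glue m (map ((!) a) js) (map ((!) b) js) ! j"
      using that by (simp add: nth_glue)
  qed simp
  have "set (map ((!) b) js) \<subseteq> set b" if "length b = d"
    using that js by auto
  then have "(m, map ((!) b) js) \<in> residual R (map ((!) a) js)"
    using a b * by (auto simp: in_residual)
  then show "(m, b) \<in> residual (\<lambda>e. R (map ((!) e) js)) a'"
    using a b * unfolding eq by (auto simp: in_residual)
qed (use R in \<open>auto simp: few_residuals_def intro!: imageI\<close>)

text \<open>The carry from the lower parts is 0 or 1.\<close>

lemma append_digits_add_iff:
  fixes a b c x y z K :: nat
  assumes "x < K" "y < K" "z < K"
  shows "(a * K + x) + (b * K + y) = c * K + z \<longleftrightarrow>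
    (a + b = c \<and> x + y = z) \<or> (Suc (a + b) = c \<and> x + y = K + z)"
proof
  assume *: "(a * K + x) + (b * K + y) = c * K + z"
  have K: "0 < K"
    using assms by simp
  have e: "c * K + z = (a + b) * K + (x + y)"
    using * by (simp add: algebra_simps)
  have "c = ((a + b) * K + (x + y)) div K" "z = ((a + b) * K + (x + y)) mod K"
    using assms by (auto simp flip: e)
  then have c: "c = (a + b) + (x + y) div K" "z = (x + y) mod K"
    using K by auto
  show "(a + b = c \<and> x + y = z) \<or> (Suc (a + b) = c \<and> x + y = K + z)"
  proof (cases "x + y < K")
    case False
    then have "(x + y) div K = 1" "(x + y) mod K = x + y - K"
      using assms by (auto simp: div_nat_eqI le_mod_geq)
    then show ?thesis
      using c False by simp
  qed (use c in auto)
qed (auto simp: algebra_simps)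

text \<open>The three classes are: the leading parts add up, they add up after a carry from the
  right, or no continuation can succeed.\<close>

lemma few_residuals_add: "few_residuals 3 3 (\<lambda>e. e ! 0 + e ! 1 = e ! 2)"
proof (rule few_residualsI[where S = "{..<3}" and
      g = "\<lambda>a. if a ! 0 + a ! 1 = a ! 2 then 0 else if Suc (a ! 0 + a ! 1) = a ! 2 then 1 else 2"])
  fix a a' m b
  assume a: "length a = 3" "length a' = 3"
    "(if a ! 0 + a ! 1 = a ! 2 then 0 else if Suc (a ! 0 + a ! 1) = a ! 2 then 1 else 2) =
     (if a' ! 0 + a' ! 1 = a' ! 2 then 0 else if Suc (a' ! 0 + a' ! 1) = a' ! 2 then 1 else 2 :: nat)"
    and b: "(m, b) \<in> residual (\<lambda>e. e ! 0 + e ! 1 = e ! 2) a"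
  have l: "length b = 3" "set b \<subseteq> {..<k ^ m}"
    using a b by (auto simp: in_residual)
  then have "b ! 0 < k ^ m" "b ! 1 < k ^ m" "b ! 2 < k ^ m"
    by (auto simp: subset_iff)
  then have "glue m c b ! 0 + glue m c b ! 1 = glue m c b ! 2 \<longleftrightarrow>
      (c ! 0 + c ! 1 = c ! 2 \<and> b ! 0 + b ! 1 = b ! 2) \<or>
      (Suc (c ! 0 + c ! 1) = c ! 2 \<and> b ! 0 + b ! 1 = k ^ m + b ! 2)" if "length c = 3" for c
    using that l(1) append_digits_add_iff by (simp add: nth_glue)
  with a b l show "(m, b) \<in> residual (\<lambda>e. e ! 0 + e ! 1 = e ! 2) a'"
    by (auto simp: in_residual split: if_splits)
qed auto

text \<open>The least number with a given residual has at most \<open>N\<close> digits: otherwise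
  two of its prefixes share their residual, and the digits between them can be cut out.\<close>

lemma residual_pumping:
  assumes "few_residuals (Suc d) N R"
  shows "\<exists>c'<k ^ N. residual R (c' # replicate d 0) = residual R (c # replicate d 0)"
proof -
  let ?z = "replicate d 0"
  define c' where "c' = (LEAST c'. residual R (c' # ?z) = residual R (c # ?z))"
  have c': "residual R (c' # ?z) = residual R (c # ?z)"
    unfolding c'_def by (rule LeastI) simp
  have least: "c' \<le> x" if "residual R (x # ?z) = residual R (c # ?z)" for x
    unfolding c'_def using that by (rule Least_le)
  have "c' < k ^ N"
  proof (rule ccontr)
    assume "\<not> c' < k ^ N"
    then have ge: "k ^ N \<le> c'"
      by simp
    \<comment> \<open>These are \<open>N + 1\<close> prefixes of \<open>c'\<close>, but there are at
      most \<open>N\<close> residuals.\<close>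
    let ?r = "\<lambda>j. residual R ((c' div k ^ j) # ?z)"
    have "?r ` {..N} \<subseteq> residual R ` {a. length a = Suc d}"
      by auto
    then have "card (?r ` {..N}) \<le> N"
      using assms card_mono unfolding few_residuals_def by (meson le_trans)
    then have "\<not> inj_on ?r {..N}"
      using card_image[of ?r "{..N}"] by auto
    then obtain i j where ij: "i < j" "j \<le> N" "?r i = ?r j"
      unfolding inj_on_def by (metis atMost_iff linorder_neqE_nat)
    have "c' div k ^ j < c' div k ^ i"
    proof -
      have "k ^ i * 1 \<le> c'"
        using ge ij k_ge_2 by (metis less_imp_le_nat le_trans mult.right_neutral k_pos power_increasing
            Suc_leI One_nat_def)
      then have "0 < c' div k ^ i"
        by (simp add: div_greater_zero_iff)
      moreover have "c' div k ^ j = c' div k ^ i div k ^ (j - i)"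
        using ij(1) by (simp add: div_mult2_eq[symmetric] power_add[symmetric])
      moreover have "1 < k ^ (j - i)"
        using ij(1) k_ge_2 by (intro one_less_power) auto
      ultimately show ?thesis
        by simp
    qed
    \<comment> \<open>\<open>c'\<close> without the digits at the positions from \<open>i\<close> up
      to \<open>j - 1\<close>. It is smaller than \<open>c'\<close> since the prefix
      \<open>c' div k ^ i\<close> is positive and thus shrinks.\<close>
    define x where "x = c' div k ^ j * k ^ i + c' mod k ^ i"
    have "x < c'"
    proof -
      have "c' div k ^ j * k ^ i < c' div k ^ i * k ^ i"
        using \<open>c' div k ^ j < c' div k ^ i\<close> by simp
      then show ?thesis
        unfolding x_def using div_mult_mod_eq[of c' "k ^ i"] by linarith
    qed
    have "glue i ((c' div k ^ j) # ?z) ((c' mod k ^ i) # ?z) = x # ?z"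
         "glue i ((c' div k ^ i) # ?z) ((c' mod k ^ i) # ?z) = c' # ?z"
      using glue_zeros[of ?z d i] div_mult_mod_eq[of c' "k ^ i"] unfolding x_def by auto
    moreover have "residual R (glue i ((c' div k ^ i) # ?z) ((c' mod k ^ i) # ?z)) =
        residual R (glue i ((c' div k ^ j) # ?z) ((c' mod k ^ i) # ?z))"
      by (rule residual_extend) (use ij in auto)
    ultimately have "residual R (x # ?z) = residual R (c # ?z)"
      using c' by simp
    from least[OF this] \<open>x < c'\<close> show False
      by simp
  qed
  with c' show ?thesis
    by blast
qed

text \<open>All parameters are below \<open>k ^ m\<close>, so the leading part of the witness stands
  above zeros and \<open>residual_pumping\<close> applies to it, while the last \<open>m\<close>
  digits stay. The sum is a choice of \<open>m\<close> that is easy to compute.\<close>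

lemma bounded_witness:
  assumes "few_residuals (Suc d) N R" "length e = d" "R (y # e)"
  shows "\<exists>y<k ^ (N + sum_list e). R (y # e)"
proof -
  define m where "m = sum_list e"
  let ?z = "replicate d 0"
  have e: "set e \<subseteq> {..<k ^ m}"
  proof
    fix x assume "x \<in> set e"
    then have "x \<le> m"
      unfolding m_def by (rule member_le_sum_list) auto
    then show "x \<in> {..<k ^ m}"
      using less_k_power[of m] less_k_power[of x] power_increasing[of x m k] k_ge_2 by auto
  qed
  obtain c' where c': "c' < k ^ N" "residual R (c' # ?z) = residual R ((y div k ^ m) # ?z)"
    using residual_pumping[OF assms(1)] by blast
  have mem: "(m, (y mod k ^ m) # e) \<in> residual R (c # ?z) \<longleftrightarrow> R ((c * k ^ m + y mod k ^ m) # e)" for c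
    using e assms(2) by (auto simp: in_residual glue_zeros)
  have "(m, (y mod k ^ m) # e) \<in> residual R ((y div k ^ m) # ?z)"
    using mem[of "y div k ^ m"] assms(3) by (simp add: div_mult_mod_eq)
  then have "R ((c' * k ^ m + y mod k ^ m) # e)"
    using mem[of c'] c'(2) by simp
  moreover have "c' * k ^ m + y mod k ^ m < k ^ (N + m)"
    using append_digits_less[OF c'(1), of "y mod k ^ m" m] by (simp add: add.commute)
  ultimately show ?thesis
    unfolding m_def by blast
qed

section \<open>Definable relations\<close>

definition state :: "'a dfao \<Rightarrow> nat \<Rightarrow> nat" where
  "state M i = foldl (trans M) (init M) (canonical_rep k i)"

lemma dfao_seq_state: "dfao_seq k M i = out M (state M i)"
  by (simp add: dfao_seq_def state_def)

lemma state_rec: "state M i = (if i = 0 then init M else trans M (state M (i div k)) (i mod k))"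
  unfolding state_def by (subst canonical_rep.simps) (use k_ge_2 in auto)

lemma state_0 [simp]: "state M 0 = init M"
  by (subst state_rec) simp

lemma state_less: "is_dfao k M \<Longrightarrow> state M i < num_states M"
proof (induction i rule: less_induct)
  case (less i)
  show ?case
  proof (cases "i = 0")
    case False
    then have "state M (i div k) < num_states M"
      using less k_ge_2 by simp
    then show ?thesis
      using less.prems False by (subst state_rec) (simp add: is_dfao_def)
  qed (use less in \<open>simp add: is_dfao_def\<close>)
qed

text \<open>
  Leading zeros do not affect the digit strings of positive numbers only, hence the case
  distinction on zero.
\<close>

lemma state_append_digits:
  assumes "a = 0 \<longleftrightarrow> a' = 0" "state M a = state M a'" "b < k ^ m"
  shows "state M (a * k ^ m + b) = state M (a' * k ^ m + b)"
  using assms(3)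
proof (induction m arbitrary: b)
  case 0
  then show ?case
    using assms by simp
next
  case (Suc m)
  have "b div k < k ^ m"
    using Suc.prems by (simp add: less_mult_imp_div_less mult.commute)
  then have IH: "state M (a * k ^ m + b div k) = state M (a' * k ^ m + b div k)"
    by (rule Suc.IH)
  have *: "(c * k ^ Suc m + b) div k = c * k ^ m + b div k" "(c * k ^ Suc m + b) mod k = b mod k" for c
  proof -
    have "c * k ^ Suc m + b = b + (c * k ^ m) * k"
      by simp
    then show "(c * k ^ Suc m + b) div k = c * k ^ m + b div k" "(c * k ^ Suc m + b) mod k = b mod k"
      using k_pos by (simp_all only: div_mult_self1 mod_mult_self1)
  qed
  have "a * k ^ Suc m + b = 0 \<longleftrightarrow> a' * k ^ Suc m + b = 0"
    using assms(1) by simp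
  then show ?case
    using IH by (subst (1 2) state_rec) (simp only: *)
qed

text \<open>Each of the two indices contributes its state and the flag whether its leading part is
  0, hence the two factors \<open>2 * num_states M\<close>.\<close>

lemma few_residuals_seq:
  assumes "is_dfao k M"
  shows "few_residuals 2 ((2 * num_states M) * (2 * num_states M))
    (\<lambda>e. dfao_seq k M (e ! 0) = dfao_seq k M (e ! 1))"
proof (rule few_residualsI[where
      S = "(UNIV \<times> {..<num_states M}) \<times> (UNIV \<times> {..<num_states M})" and
      g = "\<lambda>a. ((a ! 0 = 0, state M (a ! 0)), (a ! 1 = 0, state M (a ! 1)))"])
  fix a a' m b
  assume a: "length a = 2" "length a' = 2"
    "((a ! 0 = 0, state M (a ! 0)), (a ! 1 = 0, state M (a ! 1))) =
     ((a' ! 0 = 0, state M (a' ! 0)), (a' ! 1 = 0, state M (a' ! 1)))"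
    and b: "(m, b) \<in> residual (\<lambda>e. dfao_seq k M (e ! 0) = dfao_seq k M (e ! 1)) a"
  have "length b = 2" "set b \<subseteq> {..<k ^ m}"
    using a b by (auto simp: in_residual)
  moreover from this have "b ! 0 < k ^ m" "b ! 1 < k ^ m"
    by (auto simp: subset_iff)
  ultimately show "(m, b) \<in> residual (\<lambda>e. dfao_seq k M (e ! 0) = dfao_seq k M (e ! 1)) a'"
    using a b state_append_digits[of "a ! 0" "a' ! 0" M "b ! 0" m]
      state_append_digits[of "a ! 1" "a' ! 1" M "b ! 1" m]
    by (auto simp: in_residual nth_glue dfao_seq_state)
next
  show "card ((UNIV \<times> {..<num_states M}) \<times> (UNIV \<times> {..<num_states M}) :: ((bool \<times> nat) \<times> (bool \<times> nat)) set)
      \<le> (2 * num_states M) * (2 * num_states M)"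
    unfolding card_cartesian_product by simp
qed (simp_all add: state_less[OF assms])

text \<open>After \<open>t\<close> steps the value is the state of the prefix
  \<open>i div k ^ (i - t)\<close>. As \<open>i < k ^ i\<close>, the index itself bounds its number
  of digits; while the prefix is still 0, the value remains the initial state.\<close>

definition coded_state :: "nat \<Rightarrow> nat \<Rightarrow> nat" where
  "coded_state c i = rec_nat (code_nth c 1)
     (\<lambda>t s. if i div k ^ (i - Suc t) = 0 then code_nth c 1
        else code_nth (code_nth (code_nth c 2) s) (i div k ^ (i - Suc t) mod k)) i"

lemma coded_state:
  assumes M: "is_dfao k M"
  shows "coded_state (dfao_code k M) i = state M i"
proof -
  let ?c = "dfao_code k M"
  have c: "code_nth ?c 1 = init M"
      "code_nth ?c 2 = list_encode (map (\<lambda>q. list_encode (map (trans M q) [0..<k])) [0..<num_states M])"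
    unfolding dfao_code_def by (simp_all add: code_nth_list_encode del: list_encode.simps)
  have tr: "code_nth (code_nth (code_nth ?c 2) q) d = trans M q d" if "q < num_states M" "d < k" for q d
    using that unfolding c by (simp add: code_nth_list_encode)
  have "rec_nat (code_nth ?c 1)
     (\<lambda>t s. if i div k ^ (i - Suc t) = 0 then code_nth ?c 1
        else code_nth (code_nth (code_nth ?c 2) s) (i div k ^ (i - Suc t) mod k)) t
     = state M (i div k ^ (i - t))" if "t \<le> i" for t
    using that
  proof (induction t)
    case 0
    then show ?case
      using less_k_power[of i] c by simp
  next
    case (Suc t)
    have "k ^ (i - t) = k ^ (i - Suc t) * k"
      using Suc.prems by (metis Suc_diff_Suc Suc_le_lessD power_Suc2)
    then have *: "i div k ^ (i - t) = i div k ^ (i - Suc t) div k"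
      by (simp only: div_mult2_eq)
    define y where "y = i div k ^ (i - Suc t)"
    have "state M y = (if y = 0 then init M else trans M (state M (y div k)) (y mod k))"
      by (rule state_rec)
    then show ?case
      using Suc c(1) tr[OF state_less[OF M], of "y mod k" "y div k"] * by (simp add: y_def)
  qed
  from this[of i] show ?thesis
    unfolding coded_state_def by simp
qed

lemma computable_coded_state:
  assumes "computable n f" "computable n g"
  shows "computable n (\<lambda>xs. coded_state (f xs) (g xs))"
proof -
  note vars = computable_tl[OF computable_tl[OF assms(1)]] computable_tl[OF computable_tl[OF assms(2)]]
    computable_tl[OF computable_hd[of n]] computable_hd[of "Suc n"]
  have q: "computable (Suc (Suc n)) (\<lambda>ys. g (tl (tl ys)) div k ^ (g (tl (tl ys)) - Suc (hd ys)))"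
    by (intro computable_div computable_power computable_diff computable_Suc computable_const vars)
  show ?thesis
    unfolding coded_state_def
    by (intro computable_rec computable_if computable_pred_eq computable_code_nth computable_mod q
        computable_const vars assms)
qed

text \<open>The two halves are carried through the induction on formulas together, because the
  decision function for a quantifier takes its search bound from \<open>T\<close>. That
  \<open>T\<close> sees only the number of states is what makes the final bounds independent of the
  sequence.\<close>

definition definable :: "nat \<Rightarrow> (nat dfao \<Rightarrow> nat list \<Rightarrow> bool) \<Rightarrow> bool" where
  "definable d R \<longleftrightarrow>
     (\<exists>T. computable 1 (\<lambda>xs. T (hd xs)) \<and>
        (\<forall>M. is_dfao k M \<longrightarrow> few_residuals d (T (num_states M)) (R M))) \<and>
     (\<exists>f. computable (Suc d) f \<and>
        (\<forall>M e. is_dfao k M \<longrightarrow> length e = d \<longrightarrow> f (dfao_code k M # e) = of_bool (R M e)))"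

lemma definableE:
  assumes "definable d R"
  obtains T f where "computable 1 (\<lambda>xs. T (hd xs))"
    "\<And>M. is_dfao k M \<Longrightarrow> few_residuals d (T (num_states M)) (R M)"
    "computable (Suc d) f"
    "\<And>M e. is_dfao k M \<Longrightarrow> length e = d \<Longrightarrow> f (dfao_code k M # e) = of_bool (R M e)"
proof -
  from assms obtain T where "computable 1 (\<lambda>xs. T (hd xs))"
    "\<forall>M. is_dfao k M \<longrightarrow> few_residuals d (T (num_states M)) (R M)"
    unfolding definable_def by (elim conjE exE) (rule that)
  moreover from assms obtain f where "computable (Suc d) f"
    "\<forall>M e. is_dfao k M \<longrightarrow> length e = d \<longrightarrow> f (dfao_code k M # e) = of_bool (R M e)"
    unfolding definable_def by (elim conjE exE) (rule that)
  ultimately show thesis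
    using that[of T f] by simp
qed

lemma definableI:
  assumes "computable 1 (\<lambda>xs. T (hd xs))"
    "\<And>M. is_dfao k M \<Longrightarrow> few_residuals d (T (num_states M)) (R M)"
    "computable (Suc d) f"
    "\<And>M e. is_dfao k M \<Longrightarrow> length e = d \<Longrightarrow> f (dfao_code k M # e) = of_bool (R M e)"
  shows "definable d R"
  unfolding definable_def
  by (rule conjI; rule exI; rule conjI; (rule assms(1,3) | (intro allI impI; rule assms(2,4); assumption)))

lemma few_residuals_cong:
  assumes "\<And>e. length e = d \<Longrightarrow> R e \<longleftrightarrow> Q e"
  shows "few_residuals d N R \<longleftrightarrow> few_residuals d N Q"
proof -
  have "residual R a = residual Q a" if "length a = d" for a
    using that assms by (auto simp: in_residual)
  then have "residual R ` {a. length a = d} = residual Q ` {a. length a = d}"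
    by auto
  then show ?thesis
    unfolding few_residuals_def by simp
qed

lemma definable_cong:
  assumes "\<And>M e. is_dfao k M \<Longrightarrow> length e = d \<Longrightarrow> R M e \<longleftrightarrow> Q M e"
  shows "definable d R \<longleftrightarrow> definable d Q"
proof -
  have "few_residuals d N (R M) \<longleftrightarrow> few_residuals d N (Q M)" if "is_dfao k M" for M N
    by (rule few_residuals_cong) (use assms that in blast)
  moreover have "of_bool (R M e) = (of_bool (Q M e) :: nat)" if "is_dfao k M" "length e = d" for M e
    using assms[OF that] by simp
  ultimately show ?thesis
    unfolding definable_def by (simp cong: imp_cong)
qed

lemma definable_neg:
  assumes "definable d R"
  shows "definable d (\<lambda>M e. \<not> R M e)"
  using assms
proof (rule definableE)
  fix T f
  assume *: "computable 1 (\<lambda>xs. T (hd xs))"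
    "\<And>M. is_dfao k M \<Longrightarrow> few_residuals d (T (num_states M)) (R M)"
    "computable (Suc d) f"
    "\<And>M e. is_dfao k M \<Longrightarrow> length e = d \<Longrightarrow> f (dfao_code k M # e) = of_bool (R M e)"
  show ?thesis
    by (rule definableI[of T _ _ "\<lambda>xs. 1 - f xs"])
      (use * in \<open>auto intro: computable_diff computable_const few_residuals_neg\<close>)
qed

lemma definable_conj:
  assumes "definable d R" "definable d Q"
  shows "definable d (\<lambda>M e. R M e \<and> Q M e)"
  using assms(1)
proof (rule definableE)
  fix T f
  assume *: "computable 1 (\<lambda>xs. T (hd xs))"
    "\<And>M. is_dfao k M \<Longrightarrow> few_residuals d (T (num_states M)) (R M)"
    "computable (Suc d) f"
    "\<And>M e. is_dfao k M \<Longrightarrow> length e = d \<Longrightarrow> f (dfao_code k M # e) = of_bool (R M e)"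
  show ?thesis
    using assms(2)
  proof (rule definableE)
    fix T' f'
    assume **: "computable 1 (\<lambda>xs. T' (hd xs))"
      "\<And>M. is_dfao k M \<Longrightarrow> few_residuals d (T' (num_states M)) (Q M)"
      "computable (Suc d) f'"
      "\<And>M e. is_dfao k M \<Longrightarrow> length e = d \<Longrightarrow> f' (dfao_code k M # e) = of_bool (Q M e)"
    show ?thesis
      by (rule definableI[of "\<lambda>n. T n * T' n" _ _ "\<lambda>xs. f xs * f' xs"])
        (use * ** in \<open>auto intro: computable_mult few_residuals_conj\<close>)
  qed
qed

lemma definable_reindex:
  assumes "definable (length js) R" and js: "set js \<subseteq> {..<d}"
  shows "definable d (\<lambda>M e. R M (map (\<lambda>i. e ! i) js))"
  using assms(1)
proof (rule definableE)
  fix T f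
  assume *: "computable 1 (\<lambda>xs. T (hd xs))"
    "\<And>M. is_dfao k M \<Longrightarrow> few_residuals (length js) (T (num_states M)) (R M)"
    "computable (Suc (length js)) f"
    "\<And>M e. is_dfao k M \<Longrightarrow> length e = length js \<Longrightarrow> f (dfao_code k M # e) = of_bool (R M e)"
  show ?thesis
  proof (rule definableI[OF *(1)])
    show "few_residuals d (T (num_states M)) (\<lambda>e. R M (map (\<lambda>i. e ! i) js))" if "is_dfao k M" for M
      by (intro few_residuals_reindex *(2) that js)
    show "computable (Suc d) (\<lambda>xs. f (map (\<lambda>i. xs ! i) (0 # map Suc js)))"
      by (rule computable_reindex) (use *(3) js in auto)
    show "f (map (\<lambda>i. (dfao_code k M # e) ! i) (0 # map Suc js)) = of_bool (R M (map (\<lambda>i. e ! i) js))"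
      if "is_dfao k M" for M e
      using *(4)[OF that, of "map (\<lambda>i. e ! i) js"] by (simp add: o_def)
  qed
qed

lemma definable_ex:
  assumes "definable (Suc d) (\<lambda>M e. P M (hd e) (tl e))"
  shows "definable d (\<lambda>M e. \<exists>y. P M y e)"
  using assms
proof (rule definableE)
  fix T f
  assume *: "computable 1 (\<lambda>xs. T (hd xs))"
    "\<And>M. is_dfao k M \<Longrightarrow> few_residuals (Suc d) (T (num_states M)) (\<lambda>e. P M (hd e) (tl e))"
    "computable (Suc (Suc d)) f"
    "\<And>M e. is_dfao k M \<Longrightarrow> length e = Suc d \<Longrightarrow> f (dfao_code k M # e) = of_bool (P M (hd e) (tl e))"
  have T: "computable n (\<lambda>xs. T (g xs))" if "computable n g" for n g
    using computable_comp[of "[g]" "\<lambda>xs. T (hd xs)" n] that *(1) by simp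
  \<comment> \<open>Entry 0 of the code is the number of states, so the bound of
    \<open>bounded_witness\<close> is computable from the arguments. This is what the computability
    of \<open>T\<close> is for.\<close>
  let ?b = "\<lambda>xs. k ^ (T (code_nth (hd xs) 0) + sum_list (tl xs))"
  show ?thesis
  proof (rule definableI[of "\<lambda>n. 2 ^ T n"])
    show "computable 1 (\<lambda>xs. 2 ^ T (hd xs))"
      by (intro computable_power computable_const *)
    show "few_residuals d (2 ^ T (num_states M)) (\<lambda>e. \<exists>y. P M y e)" if "is_dfao k M" for M
      using few_residuals_ex[OF *(2)[OF that]] by simp
    \<comment> \<open>The search puts the candidate in front of the code, whereas \<open>f\<close>
      expects the code first.\<close>
    have f': "computable (Suc (Suc d)) (\<lambda>ys. f (hd (tl ys) # hd ys # tl (tl ys)))"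
    proof -
      let ?js = "1 # 0 # map (\<lambda>i. Suc (Suc i)) [0..<d]"
      have map_js: "map (\<lambda>i. ys ! i) ?js = hd (tl ys) # hd ys # tl (tl ys)"
        if "length ys = Suc (Suc d)" for ys :: "nat list"
        using that by (auto intro!: nth_equalityI simp: nth_tl length_Suc_conv)
      have "computable (Suc (Suc d)) (\<lambda>xs. f (map (\<lambda>i. xs ! i) ?js))"
        by (rule computable_reindex) (use *(3) in auto)
      then show ?thesis
        by (rule computable_cong[THEN iffD1, rotated]) (simp only: map_js)
    qed
    have "computable_pred (Suc d) (\<lambda>xs. \<exists>y<?b xs. f (hd xs # y # tl xs) = 1)"
      by (intro computable_pred_bex computable_pred_eq f' computable_const computable_power
          computable_add T computable_code_nth computable_hd computable_tl computable_sum_list)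
    then show "computable (Suc d) (\<lambda>xs. of_bool (\<exists>y<?b xs. f (hd xs # y # tl xs) = 1))"
      by (simp add: computable_pred_def)
    fix M :: "nat dfao" and e :: "nat list"
    assume M: "is_dfao k M" and e: "length e = d"
    have n: "code_nth (dfao_code k M) 0 = num_states M"
      unfolding dfao_code_def by (simp add: code_nth_list_encode del: list_encode.simps)
    have "(\<exists>y. P M y e) \<longleftrightarrow> (\<exists>y<k ^ (T (num_states M) + sum_list e). P M y e)"
      using bounded_witness[OF *(2)[OF M] e] by auto
    also have "\<dots> \<longleftrightarrow> (\<exists>y<?b (dfao_code k M # e). f (dfao_code k M # y # e) = 1)"
      using *(4)[OF M, of "_ # e"] e n by (auto simp: of_bool_def)
    finally show "of_bool (\<exists>y<?b (dfao_code k M # e).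
        f (hd (dfao_code k M # e) # y # tl (dfao_code k M # e)) = 1) = (of_bool (\<exists>y. P M y e) :: nat)"
      by simp
  qed
qed

lemma definable_disj:
  assumes "definable d R" "definable d Q"
  shows "definable d (\<lambda>M e. R M e \<or> Q M e)"
proof -
  have "definable d (\<lambda>M e. \<not> (\<not> R M e \<and> \<not> Q M e))"
    by (intro definable_neg definable_conj assms)
  then show ?thesis
    unfolding de_Morgan_conj not_not .
qed

lemma definable_imp:
  assumes "definable d R" "definable d Q"
  shows "definable d (\<lambda>M e. R M e \<longrightarrow> Q M e)"
  unfolding imp_conv_disj by (intro definable_disj definable_neg assms)

lemma definable_iff:
  assumes "definable d R" "definable d Q"
  shows "definable d (\<lambda>M e. R M e \<longleftrightarrow> Q M e)"
  unfolding iff_conv_conj_imp by (intro definable_conj definable_imp assms)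

lemma definable_all:
  assumes "definable (Suc d) (\<lambda>M e. P M (hd e) (tl e))"
  shows "definable d (\<lambda>M e. \<forall>y. P M y e)"
proof -
  have "definable d (\<lambda>M e. \<not> (\<exists>y. \<not> P M y e))"
    by (rule definable_neg, rule definable_ex, rule definable_neg, rule assms)
  then show ?thesis
    unfolding not_ex not_not .
qed

section \<open>Atomic formulas\<close>

lemma definable_add_nth:
  assumes "a < d" "b < d" "c < d"
  shows "definable d (\<lambda>M e. e ! a + e ! b = e ! c)"
proof -
  have "definable 3 (\<lambda>_ e. e ! 0 + e ! 1 = e ! 2)"
  proof (rule definableI)
    show "few_residuals 3 3 (\<lambda>e. e ! 0 + e ! 1 = e ! 2)"
      by (rule few_residuals_add)
    have "computable_pred (Suc 3) (\<lambda>xs. xs ! 1 + xs ! 2 = xs ! 3)"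
      by (intro computable_pred_eq computable_add computable_nth) auto
    then show "computable (Suc 3) (\<lambda>xs. of_bool (xs ! 1 + xs ! 2 = xs ! 3))"
      by (simp add: computable_pred_def)
  qed (auto intro: computable_const simp: numeral_eq_Suc)
  then show ?thesis
    using definable_reindex[of "[a, b, c]" "\<lambda>_ e. e ! 0 + e ! 1 = e ! 2" d] assms
    by (simp add: numeral_eq_Suc)
qed

text \<open>The atomic formula compares two positions instead of a position with a fixed letter, so
  the same formula serves every alphabet.\<close>

lemma definable_seq_nth:
  assumes "a < d" "b < d"
  shows "definable d (\<lambda>M e. dfao_seq k M (e ! a) = dfao_seq k M (e ! b))"
proof -
  have "definable 2 (\<lambda>M e. dfao_seq k M (e ! 0) = dfao_seq k M (e ! 1))"
  proof (rule definableI[of "\<lambda>n. (2 * n) * (2 * n)"])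
    let ?f = "\<lambda>xs i. code_nth (code_nth (hd xs) 3) (coded_state (hd xs) (xs ! i))"
    have "computable_pred (Suc 2) (\<lambda>xs. ?f xs 1 = ?f xs 2)"
      by (intro computable_pred_eq computable_code_nth computable_coded_state computable_nth
          computable_hd computable_const) auto
    then show "computable (Suc 2) (\<lambda>xs. of_bool (?f xs 1 = ?f xs 2))"
      by (simp add: computable_pred_def)
    show "computable 1 (\<lambda>xs. (2 * hd xs) * (2 * hd xs))"
      using computable_hd[of 0] by (intro computable_mult computable_const) auto
    fix M :: "nat dfao" and e :: "nat list"
    assume M: "is_dfao k M" and e: "length e = 2"
    have "code_nth (dfao_code k M) 3 = list_encode (map (out M) [0..<num_states M])"
      unfolding dfao_code_def by (simp add: code_nth_list_encode del: list_encode.simps)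
    then have "?f (dfao_code k M # e) (Suc i) = dfao_seq k M (e ! i)" for i
      using state_less[OF M] by (simp add: coded_state[OF M] code_nth_list_encode dfao_seq_state)
    from this[of 0] this[of 1]
    show "of_bool (?f (dfao_code k M # e) 1 = ?f (dfao_code k M # e) 2) =
        (of_bool (dfao_seq k M (e ! 0) = dfao_seq k M (e ! 1)) :: nat)"
      by (simp add: numeral_eq_Suc)
  qed (rule few_residuals_seq)
  then show ?thesis
    using definable_reindex[of "[a, b]" "\<lambda>M e. dfao_seq k M (e ! 0) = dfao_seq k M (e ! 1)" d] assms
    by (simp add: numeral_2_eq_2)
qed

lemma definable_le_nth:
  assumes "a < d" "b < d"
  shows "definable d (\<lambda>M e. e ! a \<le> e ! b)"
proof -
  have "definable (Suc d) (\<lambda>M e. e ! Suc a + e ! 0 = e ! Suc b)"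
    using assms by (intro definable_add_nth) auto
  then have "definable (Suc d) (\<lambda>M e. tl e ! a + hd e = tl e ! b)"
    by (rule definable_cong[THEN iffD1, rotated]) (use assms in \<open>auto simp: length_Suc_conv\<close>)
  then have "definable d (\<lambda>M e. \<exists>y. e ! a + y = e ! b)"
    by (rule definable_ex)
  then show ?thesis
    by (simp add: le_iff_add eq_commute)
qed

lemma definable_eq_nth: "a < d \<Longrightarrow> b < d \<Longrightarrow> definable d (\<lambda>M e. e ! a = e ! b)"
  using definable_conj[OF definable_le_nth[of a d b] definable_le_nth[of b d a]]
  by (simp add: order_eq_iff)

text \<open>Terms, represented by their graphs. The list \<open>e\<close> is an environment in the
  style of de Bruijn indices: a quantifier pushes its variable, which is then \<open>hd\<close>, and
  \<open>tl\<close> lifts the outer terms.\<close>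

definition definable_fun :: "nat \<Rightarrow> (nat list \<Rightarrow> nat) \<Rightarrow> bool" where
  "definable_fun d f \<longleftrightarrow> definable (Suc d) (\<lambda>_ e. hd e = f (tl e))"

lemma definable_fun_hd: "definable_fun (Suc d) hd"
proof -
  have "definable (Suc (Suc d)) (\<lambda>M e. e ! 0 = e ! 1)"
    by (rule definable_eq_nth) auto
  then show ?thesis
    unfolding definable_fun_def
    by (rule definable_cong[THEN iffD1, rotated]) (auto simp: length_Suc_conv)
qed

lemma definable_fun_tl:
  assumes "definable_fun d f"
  shows "definable_fun (Suc d) (\<lambda>e. f (tl e))"
proof -
  let ?js = "0 # map (\<lambda>i. Suc (Suc i)) [0..<d]"
  have map_js: "map (\<lambda>i. ys ! i) ?js = hd ys # tl (tl ys)"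
    if "length ys = Suc (Suc d)" for ys :: "nat list"
    using that by (auto intro!: nth_equalityI simp: nth_tl length_Suc_conv)
  have "definable (Suc (Suc d)) (\<lambda>M e. hd (map (\<lambda>i. e ! i) ?js) = f (tl (map (\<lambda>i. e ! i) ?js)))"
    by (rule definable_reindex) (use assms in \<open>auto simp: definable_fun_def\<close>)
  then show ?thesis
    unfolding definable_fun_def
    by (rule definable_cong[THEN iffD1, rotated]) (simp only: map_js list.sel)
qed

text \<open>
  A relation applied to definable arguments is definable because every argument can be replaced
  by an existentially quantified variable that is constrained by the graph of the argument.
\<close>

lemma definable_arg:
  assumes "definable_fun d f" "definable (Suc d) (\<lambda>M e. P M (hd e) (tl e))"
  shows "definable d (\<lambda>M e. P M (f e) e)"
proof -
  have "definable d (\<lambda>M e. \<exists>y. y = f e \<and> P M y e)"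
    using assms by (intro definable_ex definable_conj) (auto simp: definable_fun_def)
  then show ?thesis
    by simp
qed

lemma definable_eq:
  assumes "definable_fun d f" "definable_fun d g"
  shows "definable d (\<lambda>M e. f e = g e)"
  by (rule definable_arg[OF assms(1), of "\<lambda>M y e. y = g e"])
    (use assms(2) in \<open>simp add: definable_fun_def\<close>)

lemma definable_le:
  assumes "definable_fun d f" "definable_fun d g"
  shows "definable d (\<lambda>M e. f e \<le> g e)"
proof -
  \<comment> \<open>The innermost variable 0 is replaced by \<open>g\<close> first and variable 1 by
    \<open>f\<close> afterwards, hence the order of the indices.\<close>
  have "definable (Suc (Suc d)) (\<lambda>M e. e ! 1 \<le> e ! 0)"
    by (rule definable_le_nth) auto
  then have "definable (Suc (Suc d)) (\<lambda>M e. hd (tl e) \<le> hd e)"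
    by (rule definable_cong[THEN iffD1, rotated]) (auto simp: length_Suc_conv)
  then have "definable (Suc d) (\<lambda>M e. hd e \<le> g (tl e))"
    by (rule definable_arg[OF definable_fun_tl[OF assms(2)], of "\<lambda>M y e. hd e \<le> y"])
  then show ?thesis
    by (rule definable_arg[OF assms(1), of "\<lambda>M y e. y \<le> g e"])
qed

lemma definable_less: "definable_fun d f \<Longrightarrow> definable_fun d g \<Longrightarrow> definable d (\<lambda>M e. f e < g e)"
  using definable_neg[OF definable_le[of d g f]] by (simp add: not_le)

lemma definable_seq_eq:
  assumes "definable_fun d f" "definable_fun d g"
  shows "definable d (\<lambda>M e. dfao_seq k M (f e) = dfao_seq k M (g e))"
proof -
  have "definable (Suc (Suc d)) (\<lambda>M e. dfao_seq k M (e ! 1) = dfao_seq k M (e ! 0))"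
    by (rule definable_seq_nth) auto
  then have "definable (Suc (Suc d)) (\<lambda>M e. dfao_seq k M (hd (tl e)) = dfao_seq k M (hd e))"
    by (rule definable_cong[THEN iffD1, rotated]) (auto simp: length_Suc_conv)
  then have "definable (Suc d) (\<lambda>M e. dfao_seq k M (hd e) = dfao_seq k M (g (tl e)))"
    by (rule definable_arg[OF definable_fun_tl[OF assms(2)],
          of "\<lambda>M y e. dfao_seq k M (hd e) = dfao_seq k M y"])
  then show ?thesis
    by (rule definable_arg[OF assms(1), of "\<lambda>M y e. dfao_seq k M y = dfao_seq k M (g e)"])
qed

lemma definable_fun_add:
  assumes "definable_fun d f" "definable_fun d g"
  shows "definable_fun d (\<lambda>e. f e + g e)"
proof -
  have "definable (Suc (Suc (Suc d))) (\<lambda>M e. e ! 1 + e ! 0 = e ! 2)"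
    by (rule definable_add_nth) auto
  then have "definable (Suc (Suc (Suc d))) (\<lambda>M e. hd (tl e) + hd e = hd (tl (tl e)))"
    by (rule definable_cong[THEN iffD1, rotated]) (auto simp: length_Suc_conv)
  then have "definable (Suc (Suc d)) (\<lambda>M e. hd e + g (tl (tl e)) = hd (tl e))"
    by (rule definable_arg[OF definable_fun_tl[OF definable_fun_tl[OF assms(2)]],
          of "\<lambda>M y e. hd e + y = hd (tl e)"])
  then have "definable (Suc d) (\<lambda>M e. f (tl e) + g (tl e) = hd e)"
    by (rule definable_arg[OF definable_fun_tl[OF assms(1)], of "\<lambda>M y e. y + g (tl e) = hd e"])
  then show ?thesis
    by (simp add: definable_fun_def eq_commute)
qed

text \<open>The successor is characterized by the order, since constants other than 0 are themselves
  built from it.\<close>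

lemma definable_fun_Suc:
  assumes "definable_fun d f"
  shows "definable_fun d (\<lambda>e. Suc (f e))"
proof -
  have "definable (Suc d) (\<lambda>M e. f (tl e) < hd e \<and> (\<forall>z. f (tl e) < z \<longrightarrow> hd e \<le> z))"
    by (intro definable_conj definable_all definable_imp definable_less definable_le
        definable_fun_hd definable_fun_tl assms)
  moreover have "x = Suc y \<longleftrightarrow> y < x \<and> (\<forall>z. y < z \<longrightarrow> x \<le> z)" for x y
    by (auto simp: Suc_le_eq intro: antisym)
  ultimately show ?thesis
    unfolding definable_fun_def by (simp only:)
qed

lemma definable_fun_const: "definable_fun d (\<lambda>_. c)"
proof (induction c)
  case 0
  have "definable (Suc d) (\<lambda>M e. e ! 0 + e ! 0 = e ! 0)"
    by (rule definable_add_nth) auto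
  then show ?case
    unfolding definable_fun_def
    by (rule definable_cong[THEN iffD1, rotated]) (auto simp: length_Suc_conv)
qed (rule definable_fun_Suc)

lemma definable_fun_diff:
  assumes "definable_fun d f" "definable_fun d g"
  shows "definable_fun d (\<lambda>e. f e - g e)"
proof -
  have "definable (Suc d) (\<lambda>M e. hd e + g (tl e) = f (tl e) \<or> (f (tl e) \<le> g (tl e) \<and> hd e = 0))"
    by (intro definable_disj definable_conj definable_eq definable_le definable_fun_add
        definable_fun_hd definable_fun_tl definable_fun_const assms)
  moreover have "x = y - z \<longleftrightarrow> x + z = y \<or> (y \<le> z \<and> x = 0)" for x y z :: nat
    by auto
  ultimately show ?thesis
    unfolding definable_fun_def by (simp only:)
qed

text \<open>With these rules definability follows the syntax of a formula. What remains is to bring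
  every property into a form that uses only these constructs.\<close>

lemmas definable_intros = definable_neg definable_conj definable_disj definable_imp definable_iff
  definable_ex definable_all definable_eq definable_le definable_less definable_seq_eq
  definable_fun_hd definable_fun_tl definable_fun_add definable_fun_diff definable_fun_Suc
  definable_fun_const

end

section \<open>Factors as windows of a sequence\<close>

text \<open>Start and length turn a factor into two numbers, over which a formula can
  quantify.\<close>

definition fac :: "(nat \<Rightarrow> 'a) \<Rightarrow> nat \<Rightarrow> nat \<Rightarrow> 'a list" where
  "fac x i n = map x [i..<i + n]"

lemma length_fac [simp]: "length (fac x i n) = n"
  by (simp add: fac_def)

lemma nth_fac [simp]: "t < n \<Longrightarrow> fac x i n ! t = x (i + t)"
  by (simp add: fac_def)

lemma fac_0 [simp]: "fac x i 0 = []"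
  by (simp add: fac_def)

lemma fac_eq_iff: "fac x i n = w \<longleftrightarrow> length w = n \<and> (\<forall>t<n. x (i + t) = w ! t)"
  by (auto simp: list_eq_iff_nth_eq)

lemma fac_eq_fac_iff: "fac x i n = fac y j n \<longleftrightarrow> (\<forall>t<n. x (i + t) = y (j + t))"
  by (simp add: fac_eq_iff)

lemma fac_Suc: "fac x i (Suc n) = fac x i n @ [x (i + n)]"
  by (simp add: fac_def)

lemma fac_add: "fac x i (m + n) = fac x i m @ fac x (i + m) n"
  by (induction n) (simp_all add: fac_Suc add.assoc)

lemma fac_shift: "fac x a m = fac x b m \<Longrightarrow> t + l \<le> m \<Longrightarrow> fac x (a + t) l = fac x (b + t) l"
  by (simp add: fac_eq_fac_iff add.assoc)

lemma set_fac: "set (fac x i n) = (\<lambda>t. x (i + t)) ` {..<n}"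
  by (induction n) (auto simp: fac_Suc lessThan_Suc)

lemma is_factor_iff: "is_factor w x \<longleftrightarrow> (\<exists>i. w = fac x i (length w))"
proof
  assume "is_factor w x"
  then obtain i j where "w = map x [i..<j]"
    unfolding is_factor_def by blast
  then have "w = fac x i (length w)"
    by (cases "i \<le> j") (auto simp: fac_def)
  then show "\<exists>i. w = fac x i (length w)" ..
qed (auto simp: is_factor_def fac_def)

text \<open>Parts of a window are adjacent windows; prefixes, suffixes, sublists and occurrences are
  all translated through this.\<close>

lemma append_eq_fac:
  "p @ w @ s = fac x i n \<longleftrightarrow> length p + length w + length s = n \<and> p = fac x i (length p) \<and>
    w = fac x (i + length p) (length w) \<and> s = fac x (i + length p + length w) (length s)"
  (is "?l \<longleftrightarrow> ?r")
proof
  assume l: ?l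
  from arg_cong[OF l, of length] have n: "n = length p + (length w + length s)"
    by simp
  then have "fac x i n = fac x i (length p) @ fac x (i + length p) (length w) @
      fac x (i + length p + length w) (length s)"
    by (simp add: fac_add)
  with l n show ?r
    by simp
next
  assume r: ?r
  then have n: "n = length p + (length w + length s)"
    by simp
  show ?l
    unfolding n fac_add using r by (simp add: add.assoc)
qed

lemma sublist_fac: "sublist w (fac x i n) \<longleftrightarrow> (\<exists>p. p + length w \<le> n \<and> w = fac x (i + p) (length w))"
proof
  assume "sublist w (fac x i n)"
  then obtain p s where "p @ w @ s = fac x i n"
    unfolding sublist_def by metis
  then show "\<exists>p. p + length w \<le> n \<and> w = fac x (i + p) (length w)"
    unfolding append_eq_fac by (intro exI[of _ "length p"]) simp
next
  assume "\<exists>p. p + length w \<le> n \<and> w = fac x (i + p) (length w)"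
  then obtain p where p: "p + length w \<le> n" "w = fac x (i + p) (length w)"
    by blast
  then have "fac x i p @ w @ fac x (i + p + length w) (n - p - length w) = fac x i n"
    unfolding append_eq_fac by simp
  then show "sublist w (fac x i n)"
    unfolding sublist_def by metis
qed

lemma occurrences_fac:
  "occurrences (fac x i n) w = card {p. p + length w \<le> n \<and> w = fac x (i + p) (length w)}"
proof -
  have "bij_betw length {p. \<exists>s. fac x i n = p @ w @ s} {p. p + length w \<le> n \<and> w = fac x (i + p) (length w)}"
  proof (rule bij_betw_byWitness[where f' = "\<lambda>p. fac x i p"])
    show "\<forall>p\<in>{p. \<exists>s. fac x i n = p @ w @ s}. fac x i (length p) = p"
    proof clarify
      fix p s assume "fac x i n = p @ w @ s"
      then have "p @ w @ s = fac x i n" ..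
      then show "fac x i (length p) = p"
        unfolding append_eq_fac by simp
    qed
    show "length ` {p. \<exists>s. fac x i n = p @ w @ s} \<subseteq> {p. p + length w \<le> n \<and> w = fac x (i + p) (length w)}"
    proof clarify
      fix p s assume "fac x i n = p @ w @ s"
      then have "p @ w @ s = fac x i n" ..
      then show "length p + length w \<le> n \<and> w = fac x (i + length p) (length w)"
        unfolding append_eq_fac by simp
    qed
    show "fac x i ` {p. p + length w \<le> n \<and> w = fac x (i + p) (length w)} \<subseteq> {p. \<exists>s. fac x i n = p @ w @ s}"
    proof clarify
      fix p assume p: "p + length w \<le> n" "w = fac x (i + p) (length w)"
      then have "fac x i p @ w @ fac x (i + p + length w) (n - p - length w) = fac x i n"
        unfolding append_eq_fac by simp
      then show "\<exists>s. fac x i n = fac x i p @ w @ s"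
        by metis
    qed
  qed simp
  then show ?thesis
    unfolding occurrences_def by (rule bij_betw_same_card)
qed

section \<open>Characterizations without counting\<close>

lemma palindrome_fac: "palindrome (fac x i n) \<longleftrightarrow> (\<forall>s t. Suc (s + t) = n \<longrightarrow> x (i + s) = x (i + t))"
proof -
  have "palindrome (fac x i n) \<longleftrightarrow> (\<forall>t<n. x (i + (n - Suc t)) = x (i + t))"
    unfolding palindrome_def eq_commute[of "rev _"] fac_eq_iff by (auto simp: rev_nth)
  also have "\<dots> \<longleftrightarrow> (\<forall>s t. Suc (s + t) = n \<longrightarrow> x (i + s) = x (i + t))"
  proof (intro iffI allI impI)
    fix s t assume "\<forall>t<n. x (i + (n - Suc t)) = x (i + t)" "Suc (s + t) = n"
    then show "x (i + s) = x (i + t)"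
      by (auto dest: spec[of _ t])
  next
    fix t assume "\<forall>s t. Suc (s + t) = n \<longrightarrow> x (i + s) = x (i + t)" "t < n"
    then show "x (i + (n - Suc t)) = x (i + t)"
      by (auto dest: spec[of _ "n - Suc t"])
  qed
  finally show ?thesis .
qed

text \<open>The letter around an extension is read off at position \<open>j\<close>, so that only
  positions are quantified.\<close>

lemma maximal_palindrome_fac:
  "maximal_palindrome x (fac x i n) \<longleftrightarrow> palindrome (fac x i n) \<and>
     \<not> (\<exists>j. fac x (Suc j) n = fac x i n \<and> x j = x (Suc (j + n)))"
proof -
  have "is_factor ([a] @ fac x i n @ [a]) x \<longleftrightarrow>
      (\<exists>j. x j = a \<and> fac x (Suc j) n = fac x i n \<and> x (Suc (j + n)) = a)" for a
  proof -
    have "[a] @ fac x i n @ [a] = fac x j (Suc (Suc n)) \<longleftrightarrow>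
        x j = a \<and> fac x (Suc j) n = fac x i n \<and> x (Suc (j + n)) = a" for j
      unfolding append_eq_fac by (auto simp: fac_def)
    then show ?thesis
      unfolding is_factor_iff by simp
  qed
  moreover have "is_factor (fac x i n) x"
    unfolding is_factor_iff by auto
  ultimately show ?thesis
    unfolding maximal_palindrome_def by auto
qed

section \<open>Borders, closed and privileged words\<close>

lemma border_fac:
  "border w (fac x i n) \<longleftrightarrow> w \<noteq> [] \<and> length w \<le> n \<and> w = fac x i (length w) \<and>
     w = fac x (i + (n - length w)) (length w)"
proof -
  have "prefix w (fac x i n) \<longleftrightarrow> length w \<le> n \<and> w = fac x i (length w)"
  proof
    assume "prefix w (fac x i n)"
    then obtain s where "[] @ w @ s = fac x i n"
      by (auto simp: prefix_def)
    then show "length w \<le> n \<and> w = fac x i (length w)"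
      unfolding append_eq_fac by simp
  next
    assume "length w \<le> n \<and> w = fac x i (length w)"
    then have "[] @ w @ fac x (i + length w) (n - length w) = fac x i n"
      unfolding append_eq_fac by simp
    then show "prefix w (fac x i n)"
      by (metis append_Nil prefixI)
  qed
  moreover have "suffix w (fac x i n) \<longleftrightarrow> length w \<le> n \<and> w = fac x (i + (n - length w)) (length w)"
  proof
    assume "suffix w (fac x i n)"
    then obtain p where "p @ w @ [] = fac x i n"
      by (auto simp: suffix_def)
    then show "length w \<le> n \<and> w = fac x (i + (n - length w)) (length w)"
      unfolding append_eq_fac by auto
  next
    assume "length w \<le> n \<and> w = fac x (i + (n - length w)) (length w)"
    then have l: "length w \<le> n" and e: "w = fac x (i + (n - length w)) (length w)"
      by blast+
    have "fac x i (n - length w) @ w @ [] = fac x i n"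
      unfolding append_eq_fac length_fac e[symmetric] using l by simp
    then show "suffix w (fac x i n)"
      by (metis append_Nil2 suffixI)
  qed
  ultimately show ?thesis
    unfolding border_def by blast
qed

text \<open>The window is a complete first return to its prefix of length \<open>m\<close>.\<close>

definition first_return :: "(nat \<Rightarrow> 'a) \<Rightarrow> nat \<Rightarrow> nat \<Rightarrow> nat \<Rightarrow> bool" where
  "first_return x i n m \<longleftrightarrow> 0 < m \<and> m < n \<and> fac x i m = fac x (i + (n - m)) m \<and>
     (\<forall>p. 0 < p \<and> p + m < n \<longrightarrow> fac x (i + p) m \<noteq> fac x i m)"

text \<open>A border always occurs at the positions 0 and \<open>n - m\<close>, so having exactly
  two occurrences means that these differ and no position between them is an occurrence. The
  predicate \<open>Q\<close> is trivial for closed words and is \<open>privileged\<close> for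
  privileged ones.\<close>

lemma return_border_fac:
  "(\<exists>w. border w (fac x i n) \<and> occurrences (fac x i n) w = 2 \<and> Q w) \<longleftrightarrow>
   (\<exists>m. first_return x i n m \<and> Q (fac x i m))"
proof -
  have iff: "occurrences (fac x i n) (fac x i m) = 2 \<longleftrightarrow>
      m < n \<and> (\<forall>p. 0 < p \<and> p + m < n \<longrightarrow> fac x (i + p) m \<noteq> fac x i m)"
    if m: "m \<le> n" "fac x i m = fac x (i + (n - m)) m" for m
  proof -
    let ?O = "{p. p + m \<le> n \<and> fac x i m = fac x (i + p) m}"
    have occ: "occurrences (fac x i n) (fac x i m) = card ?O"
      by (simp add: occurrences_fac)
    have sub: "{0, n - m} \<subseteq> ?O"
      using m by auto
    have fin: "finite ?O"
      by (rule finite_subset[of _ "{..n}"]) auto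
    show ?thesis
    proof (cases "m = n")
      case True
      then have "?O = {0}"
        by auto
      then show ?thesis
        unfolding occ using True by simp
    next
      case False
      then have c2: "card {0, n - m} = 2"
        using m by simp
      have "card ?O = 2 \<longleftrightarrow> ?O = {0, n - m}"
      proof
        assume "card ?O = 2"
        then show "?O = {0, n - m}"
          using card_subset_eq[OF fin sub] c2 by simp
      next
        assume "?O = {0, n - m}"
        then show "card ?O = 2"
          by (simp only: c2)
      qed
      also have "\<dots> \<longleftrightarrow> (\<forall>p\<in>?O. p = 0 \<or> p = n - m)"
        using sub by blast
      also have "\<dots> \<longleftrightarrow> (\<forall>p. 0 < p \<and> p + m < n \<longrightarrow> fac x (i + p) m \<noteq> fac x i m)"
      proof safe
        fix p assume *: "\<forall>p\<in>?O. p = 0 \<or> p = n - m" "0 < p" "p + m < n" "fac x (i + p) m = fac x i m"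
        then have "p \<in> ?O"
          by simp
        with * have "p = 0 \<or> p = n - m"
          by blast
        with * show False
          by simp
      next
        fix p assume *: "\<forall>p. 0 < p \<and> p + m < n \<longrightarrow> fac x (i + p) m \<noteq> fac x i m"
          "p + m \<le> n" "fac x i m = fac x (i + p) m" "p \<noteq> n - m"
        then have "p + m < n"
          by linarith
        show "p = 0"
        proof (rule ccontr)
          assume "p \<noteq> 0"
          with *(1) \<open>p + m < n\<close> have "fac x (i + p) m \<noteq> fac x i m"
            by simp
          with *(3) show False
            by simp
        qed
      qed
      finally show ?thesis
        unfolding occ using False m by auto
    qed
  qed
  show ?thesis
  proof
    assume "\<exists>w. border w (fac x i n) \<and> occurrences (fac x i n) w = 2 \<and> Q w"
    then obtain w where w: "border w (fac x i n)" "occurrences (fac x i n) w = 2" "Q w"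
      by blast
    define m where "m = length w"
    have "0 < m" "m \<le> n" "w = fac x i m" "w = fac x (i + (n - m)) m"
      using w(1) unfolding border_fac m_def by auto
    with w iff[of m] have "first_return x i n m" "Q (fac x i m)"
      unfolding first_return_def by metis+
    then show "\<exists>m. first_return x i n m \<and> Q (fac x i m)"
      by blast
  next
    assume "\<exists>m. first_return x i n m \<and> Q (fac x i m)"
    then obtain m where m: "0 < m" "m < n" "fac x i m = fac x (i + (n - m)) m"
      "\<forall>p. 0 < p \<and> p + m < n \<longrightarrow> fac x (i + p) m \<noteq> fac x i m" "Q (fac x i m)"
      unfolding first_return_def by blast
    have "border (fac x i m) (fac x i n)"
      unfolding border_fac length_fac using m(1-3) by (auto simp flip: length_0_conv)
    moreover have "occurrences (fac x i n) (fac x i m) = 2"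
      using iff[OF less_imp_le[OF m(2)] m(3)] m(2,4) by blast
    ultimately show "\<exists>w. border w (fac x i n) \<and> occurrences (fac x i n) w = 2 \<and> Q w"
      using m(5) by blast
  qed
qed

lemma closed_fac: "closed_word (fac x i n) \<longleftrightarrow> n \<le> 1 \<or> (\<exists>m. first_return x i n m)"
  unfolding closed_word_def length_fac return_border_fac[of x i n "\<lambda>_. True", unfolded simp_thms]
  by (rule refl)

lemma privileged_fac_rec:
  "privileged (fac x i n) \<longleftrightarrow> n \<le> 1 \<or> (\<exists>m. first_return x i n m \<and> privileged (fac x i m))"
proof -
  have "privileged (fac x i n) \<longleftrightarrow> n \<le> 1 \<or>
      (\<exists>w. border w (fac x i n) \<and> occurrences (fac x i n) w = 2 \<and> privileged w)"
    by (subst privileged.simps) auto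
  then show ?thesis
    using return_border_fac[of x i n privileged] by simp
qed

text \<open>
  For \<open>N < n\<close> the witness is the longest border of length at most \<open>N\<close> in the chain
  of borders that shows that the word is privileged.
\<close>

lemma privileged_fac:
  "privileged (fac x i n) \<longleftrightarrow>
   (\<forall>N. 0 < N \<and> N \<le> n \<longrightarrow> (\<exists>m. 0 < m \<and> m \<le> N \<and> fac x i m = fac x (i + (n - m)) m \<and>
     (\<forall>p. 0 < p \<and> p + m \<le> N \<longrightarrow> fac x (i + p) m \<noteq> fac x i m) \<and>
     (\<forall>p. p + m < N \<longrightarrow> fac x (i + ((n - N) + p)) m \<noteq> fac x i m)))"
proof (induction n rule: less_induct)
  case (less n)
  define C where "C n N m \<longleftrightarrow> 0 < m \<and> m \<le> N \<and> fac x i m = fac x (i + (n - m)) m \<and>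
     (\<forall>p. 0 < p \<and> p + m \<le> N \<longrightarrow> fac x (i + p) m \<noteq> fac x i m) \<and>
     (\<forall>p. p + m < N \<longrightarrow> fac x (i + ((n - N) + p)) m \<noteq> fac x i m)" for n N m
  note IH = less.IH[folded C_def]
  \<comment> \<open>The prefix and the suffix of length \<open>N\<close> of the border are also
    those of the whole word, so both words satisfy the same condition for \<open>N\<close>.\<close>
  have transfer: "C m N m' \<longleftrightarrow> C n N m'"
    if "N \<le> m" "m < n" and eq: "fac x i m = fac x (i + (n - m)) m" for m N m'
  proof -
    have 1: "fac x (i + (m - m')) m' = fac x (i + (n - m')) m'" if "m' \<le> N"
      using fac_shift[OF eq, of "m - m'" m'] that \<open>N \<le> m\<close> \<open>m < n\<close> by simp
    have 2: "fac x (i + ((m - N) + p)) m' = fac x (i + ((n - N) + p)) m'" if "p + m' < N" for p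
      using fac_shift[OF eq, of "m - N + p" m'] that \<open>N \<le> m\<close> \<open>m < n\<close> by simp
    show ?thesis
      unfolding C_def using 1 2 by (metis (no_types, lifting))
  qed
  have "privileged (fac x i n) \<longleftrightarrow> (\<forall>N. 0 < N \<and> N \<le> n \<longrightarrow> (\<exists>m. C n N m))"
  proof (cases "n \<le> 1")
    case True
    then have "C n N N" if "0 < N" "N \<le> n" for N
      using that by (auto simp: C_def)
    then show ?thesis
      using True privileged_fac_rec[of x i n] by blast
  next
    case False
    show ?thesis
    proof
      assume "privileged (fac x i n)"
      then obtain m where m: "0 < m" "m < n" and eq: "fac x i m = fac x (i + (n - m)) m"
        and ret: "\<forall>p. 0 < p \<and> p + m < n \<longrightarrow> fac x (i + p) m \<noteq> fac x i m"
        and priv: "privileged (fac x i m)"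
        using False privileged_fac_rec[of x i n] unfolding first_return_def by blast
      show "\<forall>N. 0 < N \<and> N \<le> n \<longrightarrow> (\<exists>m. C n N m)"
      proof (intro allI impI)
        fix N assume N: "0 < N \<and> N \<le> n"
        consider "N = n" | "m \<le> N" "N < n" | "N < m"
          using N by linarith
        then show "\<exists>m. C n N m"
        proof cases
          case 1
          then have "C n N n"
            using N by (auto simp: C_def)
          then show ?thesis ..
        next
          case 2
          have "fac x (i + p) m \<noteq> fac x i m" if "0 < p" "p + m \<le> N" for p
            using ret that 2 by (meson le_less_trans)
          moreover have "fac x (i + ((n - N) + p)) m \<noteq> fac x i m" if "p + m < N" for p
          proof -
            have "0 < n - N + p" "n - N + p + m < n"
              using that 2 by auto
            then show ?thesis
              using ret by blast
          qed
          ultimately have "C n N m"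
            unfolding C_def using m eq 2 by blast
          then show ?thesis ..
        next
          case 3
          then obtain m' where "C m N m'"
            using priv N IH[OF m(2)] by (meson less_imp_le)
          then have "C n N m'"
            using transfer[OF less_imp_le[OF 3] m(2) eq] by blast
          then show ?thesis ..
        qed
      qed
    next
      assume C: "\<forall>N. 0 < N \<and> N \<le> n \<longrightarrow> (\<exists>m. C n N m)"
      \<comment> \<open>For \<open>N = n - 1\<close> the witness cannot be the word itself, and the
        condition on the prefix already excludes every occurrence strictly between the two ends. The
        smaller \<open>N\<close> pass to this border.\<close>
      then have "\<exists>m. C n (n - 1) m"
        using False by (auto simp: not_le)
      then obtain m where m: "C n (n - 1) m" ..
      then have mn: "m < n" "0 < m" 
        unfolding C_def using False by linarith+
      have eq: "fac x i m = fac x (i + (n - m)) m"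
        and ret: "\<forall>p. 0 < p \<and> p + m \<le> n - 1 \<longrightarrow> fac x (i + p) m \<noteq> fac x i m"
        using m unfolding C_def by blast+
      have "\<exists>m'. C m N m'" if N: "0 < N" "N \<le> m" for N
        using C N mn transfer[OF N(2) mn(1) eq] by (meson le_trans less_imp_le)
      then have "privileged (fac x i m)"
        using IH[OF mn(1)] by blast
      have "\<forall>p. 0 < p \<and> p + m < n \<longrightarrow> fac x (i + p) m \<noteq> fac x i m"
      proof (intro allI impI)
        fix p assume "0 < p \<and> p + m < n"
        then have "0 < p \<and> p + m \<le> n - 1"
          by linarith
        then show "fac x (i + p) m \<noteq> fac x i m"
          using ret by blast
      qed
      then have "first_return x i n m"
        unfolding first_return_def using eq mn by blast
      then show "privileged (fac x i n)"
        using privileged_fac_rec[of x i n] \<open>privileged (fac x i m)\<close> by blast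
    qed
  qed
  then show ?case
    unfolding C_def .
qed

section \<open>Rich words\<close>

text \<open>
  Every letter of a word contributes at most one new palindrome, namely the longest palindromic
  suffix of the prefix that it ends: a shorter one also occurs at the start of the longest one.
\<close>

lemma rich_fac:
  "rich (fac x i n) \<longleftrightarrow>
   (\<forall>l<n. \<exists>m\<le>Suc l. palindrome (fac x (i + (Suc l - m)) m) \<and>
     (\<forall>p. p + m \<le> l \<longrightarrow> fac x (i + p) m \<noteq> fac x (i + (Suc l - m)) m))"
proof -
  define pals where "pals n = {w. sublist w (fac x i n) \<and> palindrome w}" for n
  define new where "new l \<longleftrightarrow> (\<exists>m\<le>Suc l. palindrome (fac x (i + (Suc l - m)) m) \<and>
     (\<forall>p. p + m \<le> l \<longrightarrow> fac x (i + p) m \<noteq> fac x (i + (Suc l - m)) m))" for l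
  have fin: "finite (pals n)" for n
    by (rule finite_subset[of _ "set (sublists (fac x i n))"]) (auto simp: pals_def)
  have mono: "pals n \<subseteq> pals (Suc n)" for n
    unfolding pals_def sublist_fac by (auto intro: le_SucI)
  have mem: "w \<in> pals (Suc l) - pals l \<longleftrightarrow> (\<exists>m\<le>Suc l. w = fac x (i + (Suc l - m)) m \<and> palindrome w \<and>
     (\<forall>p. p + m \<le> l \<longrightarrow> fac x (i + p) m \<noteq> w))" for w l
  proof
    assume w: "w \<in> pals (Suc l) - pals l"
    then obtain p where p: "p + length w \<le> Suc l" "w = fac x (i + p) (length w)"
      unfolding pals_def sublist_fac by auto
    have n: "fac x (i + p) (length w) \<noteq> w" if "p + length w \<le> l" for p
      using w that unfolding pals_def sublist_fac by (auto simp: eq_commute[of w])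
    then have "p = Suc l - length w"
      using p by (metis add_diff_cancel_right' le_Suc_eq)
    then show "\<exists>m\<le>Suc l. w = fac x (i + (Suc l - m)) m \<and> palindrome w \<and>
        (\<forall>p. p + m \<le> l \<longrightarrow> fac x (i + p) m \<noteq> w)"
      using w p n by (intro exI[of _ "length w"]) (auto simp: pals_def)
  next
    assume "\<exists>m\<le>Suc l. w = fac x (i + (Suc l - m)) m \<and> palindrome w \<and>
        (\<forall>p. p + m \<le> l \<longrightarrow> fac x (i + p) m \<noteq> w)"
    then obtain m where m: "m \<le> Suc l" "w = fac x (i + (Suc l - m)) m" "palindrome w"
        "\<forall>p. p + m \<le> l \<longrightarrow> fac x (i + p) m \<noteq> w"
      by blast
    then have "length w = m"
      by simp
    with m show "w \<in> pals (Suc l) - pals l"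
      unfolding pals_def sublist_fac by (auto intro!: exI[of _ "Suc l - m"] simp: eq_commute[of w])
  qed
  have one: "v = w" if vw: "v \<in> pals (Suc l) - pals l" "w \<in> pals (Suc l) - pals l"
      "length v \<le> length w" for v w l
  proof -
    let ?m = "length v" and ?m' = "length w"
    have v: "?m \<le> Suc l" "v = fac x (i + (Suc l - ?m)) ?m" "palindrome v"
        "\<forall>p. p + ?m \<le> l \<longrightarrow> fac x (i + p) ?m \<noteq> v"
      using vw(1) unfolding mem by auto
    have w: "?m' \<le> Suc l" "w = fac x (i + (Suc l - ?m')) ?m'" "palindrome w"
      using vw(2) unfolding mem by auto
    have "fac x (i + (Suc l - ?m')) ?m = v"
    proof -
      have "w = fac x (i + (Suc l - ?m')) (?m' - ?m) @ fac x (i + (Suc l - ?m)) ?m"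
        using w fac_add[of x "i + (Suc l - ?m')" "?m' - ?m" ?m] vw(3) v(1) by simp
      then have "w = fac x (i + (Suc l - ?m')) (?m' - ?m) @ v"
        using v(2) by simp
      then have "w = v @ rev (fac x (i + (Suc l - ?m')) (?m' - ?m))"
        using w(3) v(3) unfolding palindrome_def by (metis rev_append)
      then have "[] @ v @ rev (fac x (i + (Suc l - ?m')) (?m' - ?m)) = fac x (i + (Suc l - ?m')) ?m'"
        using w(2) by simp
      then show ?thesis
        unfolding append_eq_fac by simp
    qed
    \<comment> \<open>The occurrence of \<open>v\<close> at the start of \<open>w\<close> may not
      end before the new letter, so it is the one at the end of \<open>w\<close>.\<close>
    then have "\<not> (Suc l - ?m') + ?m \<le> l"
      using v(4) by auto
    then have "?m = ?m'"
      using vw(3) w(1) by linarith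
    then show ?thesis
      using v(2) w(2) by simp
  qed
  have card_Suc: "card (pals (Suc l)) = card (pals l) + of_bool (new l)" for l
  proof -
    have "card (pals (Suc l)) = card (pals l) + card (pals (Suc l) - pals l)"
      using card_Diff_subset[OF fin mono[of l]] card_mono[OF fin mono[of l]] by simp
    moreover have "card (pals (Suc l) - pals l) = of_bool (new l)"
    proof (cases "new l")
      case True
      then obtain w where w: "w \<in> pals (Suc l) - pals l"
        unfolding mem new_def by blast
      then have "v = w" if "v \<in> pals (Suc l) - pals l" for v
        using one[OF that w] one[OF w that] by (metis linear)
      then have "pals (Suc l) - pals l = {w}"
        using w by blast
      then show ?thesis
        using True by simp
    next
      case False
      then have "w \<notin> pals (Suc l) - pals l" for w
        unfolding mem new_def by auto
      then have "pals (Suc l) - pals l = {}"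
        by blast
      then show ?thesis
        using False by (simp only:) simp
    qed
    ultimately show ?thesis
      by simp
  qed
  \<comment> \<open>The bound is proved along with the criterion: a letter without a new palindrome
    can then never be compensated later.\<close>
  have "card (pals n) \<le> Suc n \<and> (card (pals n) = Suc n \<longleftrightarrow> (\<forall>l<n. new l))" for n
  proof (induction n)
    case 0
    have "pals 0 = {[]}"
      unfolding pals_def by (auto simp: palindrome_def)
    then show ?case
      by simp
  next
    case (Suc n)
    then show ?case
      unfolding card_Suc by (auto simp: less_Suc_eq of_bool_def)
  qed
  then show ?thesis
    unfolding rich_def pals_def new_def by simp
qed

section \<open>Balanced words\<close>

lemma fac_1: "fac x i (Suc 0) = [x i]"
  by (simp add: fac_Suc)

lemma occurrences_letter:
  "int (occurrences (fac x i n) [a]) = (\<Sum>t<n. of_bool (x (i + t) = a))"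
proof -
  have "occurrences (fac x i n) [a] = card {p. p < n \<and> x (i + p) = a}"
    by (simp add: occurrences_fac fac_1 Suc_le_eq eq_commute[of a])
  also have "{p. p < n \<and> x (i + p) = a} = {..<n} \<inter> {t. x (i + t) = a}"
    by auto
  finally show ?thesis
    by (simp add: sum.If_cases of_bool_def)
qed

text \<open>
  The first time that the difference of the letter counts of two windows exceeds 1 is preceded by
  a position where the difference has increased to 1 and since when the windows have agreed.
\<close>

lemma imbalance_witness:
  assumes "(\<Sum>t<n. of_bool (x (q + t) = a)) - (\<Sum>t<n. of_bool (x (p + t) = a)) \<ge> (2 :: int)"
  shows "\<exists>r m. Suc (r + m) < n \<and> x (p + r) \<noteq> a \<and> x (p + Suc (r + m)) \<noteq> a \<and>
    x (q + r) = a \<and> x (q + Suc (r + m)) = a \<and>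
    (\<forall>t<m. x (p + Suc (r + t)) = a \<longleftrightarrow> x (q + Suc (r + t)) = a)"
proof -
  define D :: "nat \<Rightarrow> int" where "D t = of_bool (x (q + t) = a) - of_bool (x (p + t) = a)" for t
  define S where "S l = (\<Sum>t<l. D t)" for l
  have S_Suc: "S (Suc l) = S l + D l" for l
    by (simp add: S_def)
  have D1: "D t \<le> 1" for t
    by (simp add: D_def)
  define e where "e = (LEAST l. S l \<ge> 2)"
  have "S n \<ge> 2"
    using assms by (simp add: S_def D_def sum_subtractf)
  then have e: "S e \<ge> 2" "e \<le> n"
    unfolding e_def by (auto intro: LeastI Least_le)
  have less: "S l < 2" if "l < e" for l
    using not_less_Least[of l "\<lambda>l. S l \<ge> 2"] that unfolding e_def by simp
  have "e \<noteq> 0"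
    using e by (auto simp: S_def intro!: gr0I)
  then obtain e' where e': "e = Suc e'"
    by (cases e) auto
  then have Se': "S e' = 1" "D e' = 1"
    using e less[of e'] S_Suc[of e'] D1[of e'] by auto
  define J where "J = {t. t < e' \<and> D t \<noteq> 0}"
  have "J \<noteq> {}"
  proof
    assume "J = {}"
    then have "S e' = 0"
      unfolding S_def J_def by (intro sum.neutral) auto
    then show False
      using Se' by simp
  qed
  define r where "r = Max J"
  have fin: "finite J"
    unfolding J_def by simp
  have r: "r < e'" "D r \<noteq> 0"
    using Max_in[OF fin \<open>J \<noteq> {}\<close>] unfolding r_def J_def by auto
  have zero: "D t = 0" if "r < t" "t < e'" for t
  proof -
    have "t \<notin> J"
      using Max_ge[OF fin, of t] that unfolding r_def by auto
    then show ?thesis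
      using that unfolding J_def by simp
  qed
  have "S e' = S (Suc r) + (\<Sum>t\<in>{Suc r..<e'}. D t)"
    using sum.atLeastLessThan_concat[of 0 "Suc r" e' D] r(1) unfolding S_def by (simp add: atLeast0LessThan)
  also have "(\<Sum>t\<in>{Suc r..<e'}. D t) = 0"
    by (rule sum.neutral) (use zero in auto)
  finally have "S r + D r = 1"
    using Se' S_Suc by simp
  moreover have "S r < 2"
    using less[of r] r(1) e' by simp
  moreover have "D r = 1 \<or> D r = 0 \<or> D r = -1"
    by (simp add: D_def)
  \<comment> \<open>\<open>D r = -1\<close> would require \<open>S r = 2\<close>, contradicting the
    choice of \<open>e\<close> as the first such place.\<close>
  ultimately have "D r = 1"
    using r(2) by auto
  obtain m where m: "e' = Suc (r + m)"
    using r(1) less_imp_Suc_add by blast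
  have 1: "x (q + t) = a \<and> x (p + t) \<noteq> a" if "D t = 1" for t
    using that by (auto simp: D_def of_bool_def split: if_splits)
  have 0: "x (q + t) = a \<longleftrightarrow> x (p + t) = a" if "D t = 0" for t
    using that by (auto simp: D_def of_bool_def split: if_splits)
  have "D (Suc (r + t)) = 0" if "t < m" for t
    using zero that m by simp
  with 0 have "\<forall>t<m. x (p + Suc (r + t)) = a \<longleftrightarrow> x (q + Suc (r + t)) = a"
    by blast
  moreover have "Suc (r + m) < n"
    using e(2) e' m by simp
  ultimately show ?thesis
    using 1[OF \<open>D r = 1\<close>] 1[OF Se'(2)] unfolding m by blast
qed

text \<open>Generalizes the criterion that an unbalanced binary word has factors
  \<open>a u a\<close> and \<open>b u b\<close>. The letter in excess is \<open>x (i + q)\<close>;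
  over larger alphabets the inner parts need only agree on where this letter occurs.\<close>

lemma balanced_fac:
  "balanced (fac x i n) \<longleftrightarrow>
   \<not> (\<exists>p q m. Suc (p + m) < n \<and> Suc (q + m) < n \<and>
      x (i + p) \<noteq> x (i + q) \<and> x (i + Suc (p + m)) \<noteq> x (i + q) \<and> x (i + Suc (q + m)) = x (i + q) \<and>
      (\<forall>t<m. x (i + Suc (p + t)) = x (i + q) \<longleftrightarrow> x (i + Suc (q + t)) = x (i + q)))"
  (is "_ \<longleftrightarrow> \<not> ?U")
proof
  assume b: "balanced (fac x i n)"
  show "\<not> ?U"
  proof
    assume ?U
    then obtain p q m where U: "Suc (p + m) < n" "Suc (q + m) < n"
      "x (i + p) \<noteq> x (i + q)" "x (i + Suc (p + m)) \<noteq> x (i + q)" "x (i + Suc (q + m)) = x (i + q)"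
      "\<forall>t<m. x (i + Suc (p + t)) = x (i + q) \<longleftrightarrow> x (i + Suc (q + t)) = x (i + q)"
      by blast
    let ?y = "fac x (i + p) (Suc (Suc m))" and ?z = "fac x (i + q) (Suc (Suc m))" and ?a = "x (i + q)"
    have "sublist (fac x (i + p) l) (fac x i n)" if "p + l \<le> n" for p l
      unfolding sublist_fac using that by (intro exI[of _ p]) simp
    then have "sublist ?y (fac x i n)" "sublist ?z (fac x i n)"
      using U(1,2) by auto
    then have le: "\<bar>int (occurrences ?y [?a]) - int (occurrences ?z [?a])\<bar> \<le> 1"
      using b unfolding balanced_def by simp
    have "(\<Sum>t<m. of_bool (x (i + Suc (p + t)) = ?a)) = (\<Sum>t<m. of_bool (x (i + Suc (q + t)) = ?a) :: int)"
      by (rule sum.cong) (use U(6) in auto)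
    moreover have "int (occurrences (fac x (i + l) (Suc (Suc m))) [?a]) = of_bool (x (i + l) = ?a) +
        (\<Sum>t<m. of_bool (x (i + Suc (l + t)) = ?a)) + of_bool (x (i + Suc (l + m)) = ?a)" for l
      unfolding occurrences_letter sum.lessThan_Suc[of _ "Suc m"] sum.lessThan_Suc_shift[of _ m]
      by (simp add: add.assoc)
    ultimately show False
      using le U(3-5) by simp
  qed
next
  assume U: "\<not> ?U"
  \<comment> \<open>One sign of the difference is enough, since \<open>p\<close> and
    \<open>q\<close> may be exchanged.\<close>
  have le: "int (occurrences (fac x (i + q) l) [a]) - int (occurrences (fac x (i + p) l) [a]) \<le> 1"
    if pq: "p + l \<le> n" "q + l \<le> n" for p q l a
  proof (rule ccontr)
    assume "\<not> ?thesis"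
    then have "(\<Sum>t<l. of_bool (x (i + q + t) = a)) - (\<Sum>t<l. of_bool (x (i + p + t) = a)) \<ge> (2 :: int)"
      unfolding occurrences_letter by simp
    from imbalance_witness[OF this] obtain r m where
      rm: "Suc (r + m) < l" "x (i + (p + r)) \<noteq> a" "x (i + Suc (p + r + m)) \<noteq> a"
        "x (i + (q + r)) = a" "x (i + Suc (q + r + m)) = a"
        "\<forall>t<m. x (i + Suc (p + r + t)) = a \<longleftrightarrow> x (i + Suc (q + r + t)) = a"
      by (auto simp: add.assoc)
    have "Suc (p + r + m) < n" "Suc (q + r + m) < n"
      using pq rm(1) by auto
    then have ?U
      using rm(2-6) by (rule_tac x = "p + r" in exI, rule_tac x = "q + r" in exI) auto
    with U show False ..
  qed
  have *: "\<bar>int (occurrences (fac x (i + q) l) [a]) - int (occurrences (fac x (i + p) l) [a])\<bar> \<le> 1"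
    if "p + l \<le> n" "q + l \<le> n" for p q l a
    using le[of p l q a] le[of q l p a] that by (simp add: abs_le_iff)
  show "balanced (fac x i n)"
    unfolding balanced_def
  proof (intro allI impI)
    fix y z a assume yz: "sublist y (fac x i n) \<and> sublist z (fac x i n) \<and> length y = length z"
    then obtain p q where "p + length y \<le> n" "y = fac x (i + p) (length y)"
      "q + length y \<le> n" "z = fac x (i + q) (length y)"
      unfolding sublist_fac by metis
    then show "\<bar>int (occurrences y [a]) - int (occurrences z [a])\<bar> \<le> 1"
      using * by metis
  qed
qed

section \<open>Right special factors and trapezoidal words\<close>

definition right_special :: "'a list \<Rightarrow> 'a list \<Rightarrow> bool" where
  "right_special w u \<longleftrightarrow> (\<exists>a b. a \<noteq> b \<and> sublist (u @ [a]) w \<and> sublist (u @ [b]) w)"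

lemma right_special_suffix:
  assumes "right_special w (v @ u)"
  shows "right_special w u"
proof -
  have "sublist (u @ [a]) w" if "sublist ((v @ u) @ [a]) w" for a
    using that by (metis append_assoc sublist_appendI sublist_order.order.trans append_Nil2)
  then show ?thesis
    using assms unfolding right_special_def by blast
qed

lemma sublist_letters: "sublist (u @ [a]) w \<Longrightarrow> a \<in> set w"
  using set_mono_sublist[of "u @ [a]" w] by auto

lemma finite_sublists_of_length: "finite {u. sublist u w \<and> length u = m}"
  by (rule finite_subset[of _ "set (sublists w)"]) auto

text \<open>\<open>butlast\<close> maps the longer factors to the shorter ones. Only a right special
  factor has several preimages; there is at most one of each length, and with two letters it has two
  preimages.\<close>

lemma card_extensions_le:
  assumes letters: "\<And>a b c. a \<in> set w \<Longrightarrow> b \<in> set w \<Longrightarrow> c \<in> set w \<Longrightarrow> a = b \<or> b = c \<or> a = c"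
    and unique: "\<And>u v. length u = length v \<Longrightarrow> right_special w u \<Longrightarrow> right_special w v \<Longrightarrow> u = v"
  shows "card {u. sublist u w \<and> length u = Suc m} \<le> Suc (card {u. sublist u w \<and> length u = m})"
proof -
  let ?F = "\<lambda>m. {u. sublist u w \<and> length u = m}"
  have sub: "butlast ` ?F (Suc m) \<subseteq> ?F m"
    by (auto simp: sublist_def) (metis append_assoc append_butlast_last_id length_0_conv nat.simps(3))
  show ?thesis
  proof (cases "inj_on butlast (?F (Suc m))")
    case True
    then show ?thesis
      using card_inj_on_le[OF _ sub finite_sublists_of_length] by fastforce
  next
    case False
    then obtain u' v' where uv: "u' \<in> ?F (Suc m)" "v' \<in> ?F (Suc m)" "u' \<noteq> v'" "butlast u' = butlast v'"
      unfolding inj_on_def by blast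
    obtain u a where u: "u' = u @ [a]"
      using uv(1) by (cases u' rule: rev_cases) auto
    obtain b where v: "v' = u @ [b]"
      using uv(2,4) u by (cases v' rule: rev_cases) auto
    have ab: "a \<noteq> b" "sublist (u @ [a]) w" "sublist (u @ [b]) w" "length u = m"
      using uv u v by auto
    \<comment> \<open>A further collision would again be at \<open>u\<close> and would need a letter
      different from both \<open>b\<close> and each other, hence three letters.\<close>
    have "inj_on butlast (?F (Suc m) - {v'})"
    proof (rule inj_onI, rule ccontr)
      fix y z assume y: "y \<in> ?F (Suc m) - {v'}" and z: "z \<in> ?F (Suc m) - {v'}"
        and eq: "butlast y = butlast z" "y \<noteq> z"
      obtain s c where yc: "y = s @ [c]"
        using y by (cases y rule: rev_cases) auto
      obtain d where zd: "z = s @ [d]"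
        using z eq yc by (cases z rule: rev_cases) auto
      have cd: "c \<noteq> d" "sublist (s @ [c]) w" "sublist (s @ [d]) w" "length s = m"
        using y z eq yc zd by auto
      then have "s = u"
        using unique[of s u] ab unfolding right_special_def by auto
      then have "c \<noteq> b" "d \<noteq> b"
        using y z yc zd v by auto
      then show False
        using letters[of b c d] ab cd sublist_letters by metis
    qed
    then have "card (?F (Suc m) - {v'}) \<le> card (?F m)"
      using sub by (intro card_inj_on_le[OF _ _ finite_sublists_of_length]) auto
    then show ?thesis
      using uv(2) finite_sublists_of_length[of w "Suc m"] by (simp add: card_Diff_singleton)
  qed
qed

lemma trapezoidal_letters:
  assumes "trapezoidal w" "a \<in> set w" "b \<in> set w" "c \<in> set w"
  shows "a = b \<or> b = c \<or> a = c"
proof (rule ccontr)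
  assume "\<not> ?thesis"
  then have "card {[a], [b], [c]} = 3"
    by simp
  moreover have "sublist [d] w" if "d \<in> set w" for d
    using split_list[OF that] by (auto simp: sublist_def)
  then have "{[a], [b], [c]} \<subseteq> {u. sublist u w \<and> length u = 1}"
    using assms by auto
  then have "card {[a], [b], [c]} \<le> card {u. sublist u w \<and> length u = 1}"
    by (intro card_mono finite_sublists_of_length)
  moreover have "card {u. sublist u w \<and> length u = 1} \<le> 2"
    using assms(1)[unfolded trapezoidal_def, rule_format, of 1] by simp
  ultimately show False
    by simp
qed

text \<open>Only a suffix could lack an extension to the right, and \<open>rep\<close> provides an
  earlier occurrence of it, which is followed by a letter. Every member of \<open>R\<close>
  contributes a second extension.\<close>

lemma card_extensions_ge:
  assumes rep: "\<And>u. length u = m \<Longrightarrow> suffix u (w @ [z]) \<Longrightarrow> sublist u w"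
    and m: "m \<le> length w" and R: "R \<subseteq> {u. length u = m \<and> right_special (w @ [z]) u}"
  shows "card {u. sublist u (w @ [z]) \<and> length u = m} + card R
    \<le> card {u. sublist u (w @ [z]) \<and> length u = Suc m}"
proof -
  let ?F = "\<lambda>m. {u. sublist u (w @ [z]) \<and> length u = m}"
  have "\<exists>a. sublist (u @ [a]) (w @ [z])" if "u \<in> ?F m" for u
  proof -
    have "sublist u w"
      using that rep[of u] by (auto simp: sublist_snoc)
    then obtain p s where "w = p @ u @ s"
      unfolding sublist_def by blast
    then have "w @ [z] = p @ (u @ [hd (s @ [z])]) @ tl (s @ [z])"
      by (cases s) auto
    then show ?thesis
      by (metis sublist_appendI)
  qed
  then obtain e where e: "\<And>u. u \<in> ?F m \<Longrightarrow> sublist (u @ [e u]) (w @ [z])"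
    by metis
  have RF: "R \<subseteq> ?F m"
  proof
    fix u assume "u \<in> R"
    then have "length u = m" "right_special (w @ [z]) u"
      using R by auto
    then show "u \<in> ?F m"
      unfolding right_special_def using sublist_order.order.trans
      by (metis (mono_tags, lifting) mem_Collect_eq prefixI prefix_imp_sublist)
  qed
  have "\<exists>b. b \<noteq> e u \<and> sublist (u @ [b]) (w @ [z])" if "u \<in> R" for u
  proof -
    have "right_special (w @ [z]) u"
      using R that by auto
    then show ?thesis
      unfolding right_special_def by metis
  qed
  then obtain f where f: "\<And>u. u \<in> R \<Longrightarrow> f u \<noteq> e u \<and> sublist (u @ [f u]) (w @ [z])"
    by metis
  have "card (?F m) + card R = card ((\<lambda>u. u @ [e u]) ` ?F m) + card ((\<lambda>u. u @ [f u]) ` R)"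
    by (simp add: card_image inj_on_def)
  also have "\<dots> = card ((\<lambda>u. u @ [e u]) ` ?F m \<union> (\<lambda>u. u @ [f u]) ` R)"
    using finite_subset[OF RF finite_sublists_of_length] finite_sublists_of_length
    by (intro card_Un_disjoint[symmetric] finite_imageI) (auto dest!: f)
  also have "\<dots> \<le> card (?F (Suc m))"
    using e f R by (intro card_mono finite_sublists_of_length) auto
  finally show ?thesis .
qed

text \<open>
  Removing the last letter of a shortest counterexample destroys one of the two right special
  factors, so one of their extensions is a suffix that does not occur earlier. On the other hand
  its last \<open>m\<close> letters also end an extension of the other right special factor, and if
  they occur earlier, then counting extensions gives too many factors of length \<open>m + 1\<close>.
\<close>

lemma trapezoidal_right_special:
  assumes "trapezoidal w" "length u = length v" "right_special w u" "right_special w v"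
  shows "u = v"
  using assms
proof (induction w arbitrary: u v rule: rev_induct)
  case Nil
  then show ?case
    by (auto simp: right_special_def)
next
  case (snoc z w)
  let ?w = "w @ [z]" and ?F = "\<lambda>m. {u. sublist u (w @ [z]) \<and> length u = m}"
  have sub: "sublist w ?w"
    by (metis sublist_appendI append_Nil)
  have trap: "trapezoidal w"
    unfolding trapezoidal_def
  proof
    fix m
    have "{u. sublist u w \<and> length u = m} \<subseteq> ?F m"
      using sub sublist_order.order.trans by blast
    then have "card {u. sublist u w \<and> length u = m} \<le> card (?F m)"
      by (intro card_mono finite_sublists_of_length)
    also have "\<dots> \<le> m + 1"
      using snoc.prems(1) unfolding trapezoidal_def by blast
    finally show "card {u. sublist u w \<and> length u = m} \<le> m + 1" .
  qed
  have "u = v" if "length u = m" "length v = m" "right_special ?w u" "right_special ?w v" for u v m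
    using that
  proof (induction m arbitrary: u v)
    case 0
    then show ?case
      by simp
  next
    case (Suc m)
    obtain y t where u: "u = y # t"
      using Suc.prems(1) by (cases u) auto
    obtain y' t' where v: "v = y' # t'"
      using Suc.prems(2) by (cases v) auto
    \<comment> \<open>By the induction on the length these tails coincide, so \<open>u\<close> and
      \<open>v\<close> can differ only in their first letters.\<close>
    have "right_special ?w t" "right_special ?w t'"
      using right_special_suffix[of ?w "[y]" t] right_special_suffix[of ?w "[y']" t'] Suc.prems u v by auto
    then have t': "t' = t"
      using Suc u v by auto
    show ?case
    proof (rule ccontr)
      assume "u \<noteq> v"
      have len: "Suc m \<le> length w"
      proof -
        obtain a where "sublist (u @ [a]) ?w"
          using Suc.prems(3) unfolding right_special_def by blast
        then show ?thesis
          using sublist_length_le[of "u @ [a]" ?w] Suc.prems(1) by simp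
      qed
      define s where "s = drop (length ?w - Suc m) ?w"
      have s: "length s = Suc m" "suffix s ?w"
        unfolding s_def using len by (auto simp: suffix_drop)
      \<comment> \<open>If \<open>s\<close> recurs, so do all shorter suffixes. The suffixes of
        \<open>u\<close> then make the number of factors grow by at least 1 up to length
        \<open>Suc m\<close>, and \<open>u\<close> and \<open>v\<close> together add 2 in the next
        step: at least \<open>m + 4\<close> factors of length \<open>m + 2\<close>, where at most
        \<open>m + 3\<close> are allowed.\<close>
      have not_sub: "\<not> sublist s w"
      proof
        assume sw: "sublist s w"
        have rep: "sublist u' w" if "length u' \<le> Suc m" "suffix u' ?w" for u'
        proof -
          have "suffix u' s"
            using that s by (metis suffix_length_suffix)
          then show ?thesis
            using sw suffix_imp_sublist sublist_order.order.trans by blast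
        qed
        have "Suc j \<le> card (?F j)" if "j \<le> Suc m" for j
          using that
        proof (induction j)
          case 0
          have "?F 0 = {[]}"
            by auto
          then show ?case
            by simp
        next
          case (Suc j)
          define r where "r = drop (Suc m - j) u"
          have "right_special ?w r"
            unfolding r_def by (rule right_special_suffix[of _ "take (Suc m - j) u"])
              (simp add: \<open>right_special ?w u\<close>)
          then have "card (?F j) + card {r} \<le> card (?F (Suc j))"
            using Suc.prems len rep \<open>length u = Suc m\<close>
            by (intro card_extensions_ge) (auto simp: r_def)
          then show ?case
            using Suc by simp
        qed
        then have "Suc (Suc m) \<le> card (?F (Suc m))"
          by blast
        moreover have "card (?F (Suc m)) + card {u, v} \<le> card (?F (Suc (Suc m)))"
          using len rep Suc.prems by (intro card_extensions_ge) auto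
        moreover have "card (?F (Suc (Suc m))) \<le> Suc (Suc m) + 1"
          using snoc.prems(1) unfolding trapezoidal_def by blast
        ultimately show False
          using \<open>u \<noteq> v\<close> by simp
      qed
      \<comment> \<open>The lost extension of \<open>y1 # t\<close> by \<open>a\<close> occurs only
        at the end, so \<open>s = t @ [a]\<close>. With two letters available, the right special
        \<open>y2 # t\<close> is also followed by \<open>a\<close>. Its extension differs from the
        suffix, hence occurs in \<open>w\<close>, and \<open>s\<close> occurs there with it,
        contrary to \<open>not_sub\<close>.\<close>
      have last: "False" if l: "sublist (y1 # t @ [a]) ?w" "\<not> sublist (y1 # t @ [a]) w"
          "right_special ?w (y2 # t)" "right_special ?w (y1 # t)" "y1 \<noteq> y2" "length t = m" for y1 y2 a
      proof -
        have suf: "suffix r ?w" if "sublist r ?w" "\<not> sublist r w" for r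
          using that by (simp add: sublist_snoc)
        have "suffix (t @ [a]) ?w"
          using suf[OF l(1,2)] by (metis append_Cons append_Nil suffix_order.trans suffixI)
        then have sa: "s = t @ [a]"
          using s l(6) by (metis length_append_singleton suffix_length_suffix suffix_order.antisym
              order_refl)
        obtain b where b: "b \<noteq> a" "sublist ((y1 # t) @ [b]) ?w"
          using l(4) unfolding right_special_def by metis
        obtain c d where cd: "c \<noteq> d" "sublist ((y2 # t) @ [c]) ?w" "sublist ((y2 # t) @ [d]) ?w"
          using l(3) unfolding right_special_def by metis
        have "a \<in> set ?w" "c \<in> set ?w" "d \<in> set ?w"
          using l(1) sublist_letters[of "y1 # t" a ?w] sublist_letters[OF cd(2)]
            sublist_letters[OF cd(3)] by auto
        then have "a = c \<or> a = d"
          using trapezoidal_letters[OF snoc.prems(1), of a c d] cd(1) by auto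
        then have y2: "sublist ((y2 # t) @ [a]) ?w"
          using cd by auto
        have "sublist ((y2 # t) @ [a]) w"
        proof (rule ccontr)
          assume "\<not> ?thesis"
          then have "suffix ((y2 # t) @ [a]) ?w"
            using suf y2 by blast
          moreover have "suffix ((y1 # t) @ [a]) ?w"
            using suf[OF l(1,2)] by (simp only: append_Cons)
          ultimately have "(y2 # t) @ [a] = (y1 # t) @ [a]"
            by (metis length_Cons length_append_singleton suffix_length_suffix suffix_order.antisym
                order_refl)
          then show False
            using l(5) by simp
        qed
        then have "sublist (t @ [a]) w"
          by (metis append_Cons append_Nil sublist_append_leftI sublist_order.order.trans)
        then show False
          using not_sub sa by simp
      qed
      have "\<not> right_special w u \<or> \<not> right_special w v"
        using snoc.IH[OF trap, of u v] Suc.prems \<open>u \<noteq> v\<close> by auto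
      then show False
      proof
        assume "\<not> right_special w u"
        then obtain a where "sublist (u @ [a]) ?w" "\<not> sublist (u @ [a]) w"
          using Suc.prems(3) unfolding right_special_def by blast
        then show False
          using last[of y a y'] Suc.prems u v t' \<open>u \<noteq> v\<close> by simp
      next
        assume "\<not> right_special w v"
        then obtain a where "sublist (v @ [a]) ?w" "\<not> sublist (v @ [a]) w"
          using Suc.prems(4) unfolding right_special_def by blast
        then show False
          using last[of y' a y] Suc.prems u v t' \<open>u \<noteq> v\<close> by simp
      qed
    qed
  qed
  then show ?case
    using snoc.prems by blast
qed

text \<open>Removes the cardinalities. From right to left the number of factors grows by at most 1
  with each length; the converse is harder because the bound \<open>m + 1\<close> does not say that
  each single increase is at most 1.\<close>

lemma trapezoidal_iff:
  "trapezoidal w \<longleftrightarrow> (\<forall>a\<in>set w. \<forall>b\<in>set w. \<forall>c\<in>set w. a = b \<or> b = c \<or> a = c) \<and>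
     (\<forall>u v. length u = length v \<and> right_special w u \<and> right_special w v \<longrightarrow> u = v)"
proof
  assume "trapezoidal w"
  then show "(\<forall>a\<in>set w. \<forall>b\<in>set w. \<forall>c\<in>set w. a = b \<or> b = c \<or> a = c) \<and>
     (\<forall>u v. length u = length v \<and> right_special w u \<and> right_special w v \<longrightarrow> u = v)"
    using trapezoidal_letters trapezoidal_right_special by metis
next
  assume *: "(\<forall>a\<in>set w. \<forall>b\<in>set w. \<forall>c\<in>set w. a = b \<or> b = c \<or> a = c) \<and>
     (\<forall>u v. length u = length v \<and> right_special w u \<and> right_special w v \<longrightarrow> u = v)"
  have "card {u. sublist u w \<and> length u = m} \<le> m + 1" for m
  proof (induction m)
    case 0
    have "{u. sublist u w \<and> length u = 0} = {[]}"
      by auto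
    then show ?case
      by simp
  next
    case (Suc m)
    have "card {u. sublist u w \<and> length u = Suc m} \<le> Suc (card {u. sublist u w \<and> length u = m})"
      by (rule card_extensions_le) (use * in blast)+
    with Suc show ?case
      by simp
  qed
  then show "trapezoidal w"
    unfolding trapezoidal_def by blast
qed

lemma right_special_fac:
  "right_special (fac x i n) u \<longleftrightarrow> (\<exists>p q. (p + length u < n \<and> u = fac x (i + p) (length u)) \<and>
     (q + length u < n \<and> u = fac x (i + q) (length u)) \<and>
     x (i + (p + length u)) \<noteq> x (i + (q + length u)))"
proof -
  define P where "P p \<longleftrightarrow> p + length u < n \<and> u = fac x (i + p) (length u)" for p
  have ext: "sublist (u @ [a]) (fac x i n) \<longleftrightarrow> (\<exists>p. P p \<and> a = x (i + (p + length u)))" for a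
    unfolding sublist_fac P_def length_append_singleton fac_Suc append1_eq_conv
    by (simp only: Suc_le_eq add_Suc_right add.assoc conj_assoc)
  have "right_special (fac x i n) u \<longleftrightarrow>
      (\<exists>p q. P p \<and> P q \<and> x (i + (p + length u)) \<noteq> x (i + (q + length u)))"
    unfolding right_special_def ext by blast
  then show ?thesis
    unfolding P_def .
qed

text \<open>A right special factor is given by two positions with equal windows and different next
  letters, so two of them take four positions.\<close>

lemma trapezoidal_fac:
  "trapezoidal (fac x i n) \<longleftrightarrow>
   (\<forall>p q r. p < n \<and> q < n \<and> r < n \<longrightarrow>
      x (i + p) = x (i + q) \<or> x (i + q) = x (i + r) \<or> x (i + p) = x (i + r)) \<and>
   (\<forall>m p q p' q'. p + m < n \<and> q + m < n \<and> p' + m < n \<and> q' + m < n \<and>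
      fac x (i + p) m = fac x (i + q) m \<and> x (i + (p + m)) \<noteq> x (i + (q + m)) \<and>
      fac x (i + p') m = fac x (i + q') m \<and> x (i + (p' + m)) \<noteq> x (i + (q' + m)) \<longrightarrow>
      fac x (i + p) m = fac x (i + p') m)"
proof -
  have "(\<forall>u v. length u = length v \<and> right_special (fac x i n) u \<and> right_special (fac x i n) v \<longrightarrow> u = v)
    \<longleftrightarrow> (\<forall>m p q p' q'. p + m < n \<and> q + m < n \<and> p' + m < n \<and> q' + m < n \<and>
      fac x (i + p) m = fac x (i + q) m \<and> x (i + (p + m)) \<noteq> x (i + (q + m)) \<and>
      fac x (i + p') m = fac x (i + q') m \<and> x (i + (p' + m)) \<noteq> x (i + (q' + m)) \<longrightarrow>
      fac x (i + p) m = fac x (i + p') m)" (is "?l \<longleftrightarrow> ?r")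
  proof
    assume l: ?l
    show ?r
    proof (intro allI impI)
      fix m p q p' q'
      assume *: "p + m < n \<and> q + m < n \<and> p' + m < n \<and> q' + m < n \<and>
        fac x (i + p) m = fac x (i + q) m \<and> x (i + (p + m)) \<noteq> x (i + (q + m)) \<and>
        fac x (i + p') m = fac x (i + q') m \<and> x (i + (p' + m)) \<noteq> x (i + (q' + m))"
      have "right_special (fac x i n) (fac x (i + p) m)" "right_special (fac x i n) (fac x (i + p') m)"
        unfolding right_special_fac length_fac using * by blast+
      then show "fac x (i + p) m = fac x (i + p') m"
        using l by (metis length_fac)
    qed
  next
    assume r: ?r
    show ?l
    proof (intro allI impI)
      fix u v
      assume uv: "length u = length v \<and> right_special (fac x i n) u \<and> right_special (fac x i n) v"
      define m where "m = length u"
      obtain p q where pq: "p + m < n" "q + m < n" "u = fac x (i + p) m" "u = fac x (i + q) m"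
          "x (i + (p + m)) \<noteq> x (i + (q + m))"
        using uv unfolding right_special_fac m_def by blast
      obtain p' q' where pq': "p' + m < n" "q' + m < n" "v = fac x (i + p') m" "v = fac x (i + q') m"
          "x (i + (p' + m)) \<noteq> x (i + (q' + m))"
        using uv unfolding right_special_fac m_def by metis
      have "fac x (i + p) m = fac x (i + p') m"
        by (rule r[rule_format, of p m q p' q']) (use pq pq' in metis)
      then show "u = v"
        using pq pq' by simp
    qed
  qed
  moreover have "(\<forall>a\<in>set (fac x i n). \<forall>b\<in>set (fac x i n). \<forall>c\<in>set (fac x i n). a = b \<or> b = c \<or> a = c)
    \<longleftrightarrow> (\<forall>p q r. p < n \<and> q < n \<and> r < n \<longrightarrow>
      x (i + p) = x (i + q) \<or> x (i + q) = x (i + r) \<or> x (i + p) = x (i + r))"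
    unfolding set_fac by auto
  ultimately show ?thesis
    unfolding trapezoidal_iff by (rule arg_cong2[of _ _ _ _ "(\<and>)", rotated])
qed

section \<open>Automatic and regular sequences from residuals\<close>

text \<open>Numbers the residuals, so that they can serve as states and as indices of vectors and
  matrices.\<close>

lemma finite_range_index:
  fixes f :: "'a \<Rightarrow> 'b"
  assumes "finite (range f)"
  obtains ix :: "'a \<Rightarrow> nat" where "\<And>a. ix a < card (range f)" "\<And>a b. ix a = ix b \<longleftrightarrow> f a = f b"
proof -
  obtain h where h: "bij_betw h {0..<card (range f)} (range f)"
    using ex_bij_betw_nat_finite[OF assms] by blast
  then have inv: "bij_betw (inv_into {0..<card (range f)} h) (range f) {0..<card (range f)}"
    by (rule bij_betw_inv_into)
  show thesis
  proof (rule that[of "\<lambda>a. inv_into {0..<card (range f)} h (f a)"])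
    show "inv_into {0..<card (range f)} h (f a) < card (range f)" for a
      using bij_betwE[OF inv] by auto
    show "inv_into {0..<card (range f)} h (f a) = inv_into {0..<card (range f)} h (f b) \<longleftrightarrow> f a = f b" for a b
      using bij_betw_imp_inj_on[OF inv] by (auto dest: inj_onD)
  qed
qed

text \<open>Reduces linear representations to iterated sums over functions on indices.\<close>

lemma foldr_word_mat:
  fixes \<mu> :: "nat \<Rightarrow> nat \<Rightarrow> nat \<Rightarrow> 'a::comm_ring_1"
  shows "word_mat r (\<lambda>d. mat r r (\<lambda>(i, j). \<mu> d i j)) u *\<^sub>v vec r w =
    vec r (foldr (\<lambda>d g i. \<Sum>j<r. \<mu> d i j * g j) u w)"
proof (induction u)
  case Nil
  then show ?case
    by (simp add: word_mat_def)
next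
  case (Cons d u)
  let ?\<mu> = "\<lambda>d. mat r r (\<lambda>(i, j). \<mu> d i j)"
  have W: "word_mat r ?\<mu> u \<in> carrier_mat r r" for u
    by (induction u) (auto simp: word_mat_def)
  have "word_mat r ?\<mu> (d # u) *\<^sub>v vec r w = ?\<mu> d *\<^sub>v (word_mat r ?\<mu> u *\<^sub>v vec r w)"
    unfolding word_mat_def foldr.simps o_apply
    by (rule assoc_mult_mat_vec[of _ r r _ r]) (use W in \<open>auto simp: word_mat_def\<close>)
  then show ?case
    unfolding Cons.IH by (auto intro!: sum.cong simp: scalar_prod_def atLeast0LessThan)
qed

lemma regularI:
  fixes \<mu> :: "nat \<Rightarrow> nat \<Rightarrow> nat \<Rightarrow> int"
  assumes "\<And>n u. is_rep k u n \<Longrightarrow>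
    f n = (\<Sum>i<r. v i * foldr (\<lambda>d g i. \<Sum>j<r. \<mu> d i j * g j) u w i)"
  shows "regular k f"
  unfolding regular_def
proof (intro exI conjI allI impI)
  show "f n = vec r v \<bullet> (word_mat r (\<lambda>d. mat r r (\<lambda>(i, j). \<mu> d i j)) u *\<^sub>v vec r w)"
    if "is_rep k u n" for n u
    unfolding foldr_word_mat assms[OF that] by (simp add: scalar_prod_def atLeast0LessThan)
qed auto

lemma horner_sum_rev_Cons: "horner_sum id k (rev (d # u)) = d * k ^ length u + horner_sum id k (rev u)"
  for k :: nat
  by (simp add: horner_sum_append mult.commute)

context numeration
begin

lemma automatic_of_few_residuals:
  assumes "few_residuals 1 N R"
  shows "automatic k (\<lambda>n. if R [n] then 1 else 0 :: nat)"
proof -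
  have "finite (range (\<lambda>n. residual R [n]))"
    by (rule finite_subset[of _ "residual R ` {a. length a = 1}"])
      (use assms in \<open>auto simp: few_residuals_def\<close>)
  then obtain ix :: "nat \<Rightarrow> nat" where ix: "\<And>a. ix a < card (range (\<lambda>n. residual R [n]))"
      "\<And>a b. ix a = ix b \<longleftrightarrow> residual R [a] = residual R [b]"
    by (rule finite_range_index) blast
  \<comment> \<open>A number representing each residual, on which the transitions and outputs are
    computed.\<close>
  define pick where "pick q = (SOME a. ix a = q)" for q
  have "ix (pick (ix a)) = ix a" for a
    unfolding pick_def by (rule someI) simp
  then have pick: "residual R [pick (ix a)] = residual R [a]" for a
    by (simp add: ix(2))
  \<comment> \<open>Transitions do not depend on the representative.\<close>
  have step: "residual R [pick (ix a) * k + d] = residual R [a * k + d]" if "d < k" for a d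
    using residual_extend[OF pick[of a], of "[d]" 1] that by simp
  define M where "M = \<lparr>num_states = card (range (\<lambda>n. residual R [n])), init = ix 0,
    trans = (\<lambda>q d. ix (pick q * k + d)), out = (\<lambda>q. if R [pick q] then 1 else 0 :: nat)\<rparr>"
  have "state M n = ix n" for n
  proof (induction n rule: less_induct)
    case (less n)
    show ?case
    proof (cases "n = 0")
      case False
      then have "state M (n div k) = ix (n div k)"
        using less k_ge_2 by simp
      then have "state M n = ix (pick (ix (n div k)) * k + n mod k)"
        using False by (subst state_rec) (simp add: M_def)
      also have "\<dots> = ix (n div k * k + n mod k)"
        unfolding ix(2) by (rule step) simp
      finally show ?thesis
        by simp
    qed (simp add: M_def)
  qed
  moreover have "R [pick (ix n)] \<longleftrightarrow> R [n]" for n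
    using pick[of n] residual_self[of R "[n]"] residual_self[of R "[pick (ix n)]"] by simp
  ultimately have "(\<lambda>n. if R [n] then 1 else 0 :: nat) = dfao_seq k M"
    by (auto simp: dfao_seq_state M_def)
  moreover have "is_dfao k M"
    unfolding is_dfao_def M_def using ix(1) by simp
  ultimately show ?thesis
    unfolding automatic_def by blast
qed

text \<open>
  Splitting off the last \<open>length u\<close> digits of the counted numbers expresses the count as a
  combination of the numbers of solutions of the residuals. The residuals with infinitely many
  leading parts have no solution at all, and \<^const>\<open>card\<close> gives them the coefficient 0.
\<close>

lemma regular_of_few_residuals:
  assumes few: "few_residuals 2 N R" and fin: "\<And>n. finite {i. R [n, i]}"
  shows "regular k (\<lambda>n. int (card {i. R [n, i]}))"
proof -
  define res where "res = (\<lambda>(a, c). residual R [a, c])"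
  have "finite (range res)"
    by (rule finite_subset[of _ "residual R ` {a. length a = 2}"])
      (use few in \<open>auto simp: few_residuals_def res_def\<close>)
  then obtain ix :: "nat \<times> nat \<Rightarrow> nat" where ix: "\<And>a. ix a < card (range res)"
      "\<And>a b. ix a = ix b \<longleftrightarrow> res a = res b"
    by (rule finite_range_index) blast
  define r where "r = card (range res)"
  define pick where "pick q = (SOME a. ix a = q)" for q
  have "ix (pick (ix a)) = ix a" for a
    unfolding pick_def by (rule someI) simp
  then have pick: "res (pick (ix a)) = res a" for a
    by (simp add: ix(2))
  define step where "step q d d' = ix (fst (pick q) * k + d, snd (pick q) * k + d')" for q d d'
  have step: "step (ix (a, c)) d d' = ix (a * k + d, c * k + d')" if "d < k" "d' < k" for a c d d'
  proof -
    obtain a' c' where p: "pick (ix (a, c)) = (a', c')"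
      by fastforce
    then have "residual R [a', c'] = residual R [a, c]"
      using pick[of "(a, c)"] by (simp add: res_def)
    from residual_extend[OF this, of "[d, d']" 1] that show ?thesis
      unfolding step_def ix(2) p by (simp add: res_def)
  qed
  define acc where "acc q = (of_bool (R [fst (pick q), snd (pick q)]) :: int)" for q
  have acc: "acc (ix (a, c)) = of_bool (R [a, c])" for a c
  proof -
    obtain a' c' where p: "pick (ix (a, c)) = (a', c')"
      by fastforce
    then have "residual R [a', c'] = residual R [a, c]"
      using pick[of "(a, c)"] by (simp add: res_def)
    then have "R [a', c'] \<longleftrightarrow> R [a, c]"
      using residual_self[of R "[a', c']"] residual_self[of R "[a, c]"] by simp
    then show ?thesis
      unfolding acc_def p by simp
  qed
  \<comment> \<open>The digit \<open>d\<close> of \<open>n\<close> is given, while the digit of the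
    counted number is free: the entry is the number of digits that lead from \<open>q\<close> to
    \<open>q'\<close>.\<close>
  define \<mu> where "\<mu> d q q' = int (card {d'. d' < k \<and> step q d d' = q'})" for d q q'
  define sol where "sol u = foldr (\<lambda>d g q. \<Sum>q'<r. \<mu> d q q' * g q') u acc" for u
  \<comment> \<open>The solutions with leading part \<open>c\<close> when \<open>n\<close> is
    \<open>a\<close> followed by the digits \<open>u\<close>.\<close>
  define block where "block u a c = {e. e < k ^ length u \<and>
    R [a * k ^ length u + horner_sum id k (rev u), c * k ^ length u + e]}" for u a c
  have fin_block: "finite (block u a c)" for u a c
    by (rule finite_subset[of _ "{..<k ^ length u}"]) (auto simp: block_def)
  have sol: "sol u (ix (a, c)) = int (card (block u a c))" if "set u \<subseteq> {..<k}" for u a c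
    using that
  proof (induction u arbitrary: a c)
    case Nil
    have "block [] a c = (if R [a, c] then {0} else {})"
      by (auto simp: block_def)
    then show ?case
      by (simp add: sol_def acc)
  next
    case (Cons d u)
    let ?K = "k ^ length u"
    have bij: "bij_betw (\<lambda>(d', e). d' * ?K + e)
        (SIGMA d':{..<k}. block u (a * k + d) (c * k + d')) (block (d # u) a c)"
    proof (rule bij_betw_byWitness[where f' = "\<lambda>e. (e div ?K, e mod ?K)"])
      have eq: "R [a * k ^ length (d # u) + horner_sum id k (rev (d # u)), c * k ^ length (d # u) + (d' * ?K + e)]
          \<longleftrightarrow> R [(a * k + d) * ?K + horner_sum id k (rev u), (c * k + d') * ?K + e]" for d' e
        unfolding horner_sum_rev_Cons by (simp add: algebra_simps)
      show "(\<lambda>(d', e). d' * ?K + e) ` (SIGMA d':{..<k}. block u (a * k + d) (c * k + d')) \<subseteq> block (d # u) a c"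
      proof clarify
        fix d' e assume "d' < k" and e: "e \<in> block u (a * k + d) (c * k + d')"
        then have "d' * ?K + e < k ^ length (d # u)"
          using append_digits_less[of d' 1 e "length u"] by (simp add: block_def)
        then show "d' * ?K + e \<in> block (d # u) a c"
          using e eq unfolding block_def by blast
      qed
      show "(\<lambda>e. (e div ?K, e mod ?K)) ` block (d # u) a c \<subseteq> (SIGMA d':{..<k}. block u (a * k + d) (c * k + d'))"
      proof clarify
        fix e assume e: "e \<in> block (d # u) a c"
        then have "e div ?K < k"
          by (simp add: block_def less_mult_imp_div_less)
        moreover have "e mod ?K \<in> block u (a * k + d) (c * k + e div ?K)"
          using e eq[of "e div ?K" "e mod ?K"] unfolding block_def by (simp add: div_mult_mod_eq)
        ultimately show "e div ?K \<in> {..<k} \<and> e mod ?K \<in> block u (a * k + d) (c * k + e div ?K)"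
          by simp
      qed
    qed (auto simp: block_def div_mult_mod_eq)
    have "card (block (d # u) a c) = (\<Sum>d'<k. card (block u (a * k + d) (c * k + d')))"
      using bij_betw_same_card[OF bij] fin_block by simp
    then have "int (card (block (d # u) a c)) = (\<Sum>d'<k. int (card (block u (a * k + d) (c * k + d'))))"
      by simp
    also have "\<dots> = (\<Sum>d'<k. sol u (step (ix (a, c)) d d'))"
      using Cons by (intro sum.cong) (auto simp: step)
    also have "\<dots> = (\<Sum>q'<r. \<Sum>d'\<in>{d'. d' \<in> {..<k} \<and> step (ix (a, c)) d d' = q'}. sol u (step (ix (a, c)) d d'))"
      by (rule sum.group[symmetric]) (use ix(1) in \<open>auto simp: step_def r_def\<close>)
    also have "\<dots> = (\<Sum>q'<r. \<mu> d (ix (a, c)) q' * sol u q')"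
      by (intro sum.cong) (auto simp: \<mu>_def)
    finally show ?case
      by (simp add: sol_def)
  qed
  \<comment> \<open>The counted numbers may have more digits than \<open>u\<close>. Their leading
    parts \<open>c\<close> stand above leading zeros of \<open>n\<close>, hence the pairs
    \<open>(0, c)\<close>; how often each residual arises in this way is the row vector.\<close>
  have "int (card {i. R [n, i]}) = (\<Sum>q<r. int (card {c. ix (0, c) = q}) * sol u q)"
    if u: "is_rep k u n" for u n
  proof -
    let ?K = "k ^ length u"
    have set_u: "set u \<subseteq> {..<k}" and n: "horner_sum id k (rev u) = n"
      using u by (auto simp: is_rep_def)
    define C where "C = (\<lambda>i. i div ?K) ` {i. R [n, i]}"
    have fin_C: "finite C"
      unfolding C_def using fin by simp
    have block: "block u 0 c = {e. e < ?K \<and> R [n, c * ?K + e]}" for c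
      unfolding block_def n by simp
    have bij: "bij_betw (\<lambda>(c, e). c * ?K + e) (SIGMA c:C. block u 0 c) {i. R [n, i]}"
      by (rule bij_betw_byWitness[where f' = "\<lambda>i. (i div ?K, i mod ?K)"])
        (auto simp: block C_def div_mult_mod_eq)
    have "card {i. R [n, i]} = (\<Sum>c\<in>C. card (block u 0 c))"
      using bij_betw_same_card[OF bij] fin_block fin_C by simp
    then have "int (card {i. R [n, i]}) = (\<Sum>c\<in>C. int (card (block u 0 c)))"
      by simp
    also have "\<dots> = (\<Sum>c\<in>C. sol u (ix (0, c)))"
      by (simp add: sol[OF set_u])
    also have "\<dots> = (\<Sum>q<r. \<Sum>c\<in>{c. c \<in> C \<and> ix (0, c) = q}. sol u (ix (0, c)))"
      by (rule sum.group[symmetric]) (use ix(1) fin_C in \<open>auto simp: r_def\<close>)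
    also have "\<dots> = (\<Sum>q<r. int (card {c. c \<in> C \<and> ix (0, c) = q}) * sol u q)"
      by (intro sum.cong) auto
    also have "\<dots> = (\<Sum>q<r. int (card {c. ix (0, c) = q}) * sol u q)"
    proof (intro sum.cong refl)
      fix q
      show "int (card {c. c \<in> C \<and> ix (0, c) = q}) * sol u q = int (card {c. ix (0, c) = q}) * sol u q"
      proof (cases "sol u q = 0")
        case False
        have "c \<in> C" if "ix (0, c) = q" for c
        proof -
          have "block u 0 c \<noteq> {}"
            using False sol[OF set_u, of 0 c] that by auto
          then obtain e where "e < ?K" "R [n, c * ?K + e]"
            unfolding block by blast
          then show ?thesis
            unfolding C_def by (intro image_eqI[of _ _ "c * ?K + e"]) auto
        qed
        then have "{c. c \<in> C \<and> ix (0, c) = q} = {c. ix (0, c) = q}"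
          by blast
        then show ?thesis
          by simp
      qed simp
    qed
    finally show ?thesis .
  qed
  then show ?thesis
    unfolding sol_def by (rule regularI)
qed

end

section \<open>Definability of the properties\<close>

context numeration
begin

section \<open>Formulas for the seven properties\<close>

lemma definable_fac_eq:
  assumes "definable_fun d i" "definable_fun d j" "definable_fun d n"
  shows "definable d (\<lambda>M e. fac (dfao_seq k M) (i e) (n e) = fac (dfao_seq k M) (j e) (n e))"
  unfolding fac_eq_fac_iff by (intro definable_intros assms)

lemma definable_palindrome:
  assumes "definable_fun d i" "definable_fun d n"
  shows "definable d (\<lambda>M e. palindrome (fac (dfao_seq k M) (i e) (n e)))"
  unfolding palindrome_fac by (intro definable_intros assms)

lemma definable_maximal_palindrome:
  assumes "definable_fun d i" "definable_fun d n"
  shows "definable d (\<lambda>M e. maximal_palindrome (dfao_seq k M) (fac (dfao_seq k M) (i e) (n e)))"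
  unfolding maximal_palindrome_fac
  by (intro definable_intros definable_palindrome definable_fac_eq assms)

lemma definable_first_return:
  assumes "definable_fun d i" "definable_fun d n" "definable_fun d m"
  shows "definable d (\<lambda>M e. first_return (dfao_seq k M) (i e) (n e) (m e))"
  unfolding first_return_def by (intro definable_intros definable_fac_eq assms)

lemma definable_closed:
  assumes "definable_fun d i" "definable_fun d n"
  shows "definable d (\<lambda>M e. closed_word (fac (dfao_seq k M) (i e) (n e)))"
  unfolding closed_fac by (intro definable_intros definable_first_return assms)

lemma definable_privileged:
  assumes "definable_fun d i" "definable_fun d n"
  shows "definable d (\<lambda>M e. privileged (fac (dfao_seq k M) (i e) (n e)))"
  unfolding privileged_fac by (intro definable_intros definable_fac_eq assms)

lemma definable_rich:
  assumes "definable_fun d i" "definable_fun d n"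
  shows "definable d (\<lambda>M e. rich (fac (dfao_seq k M) (i e) (n e)))"
  unfolding rich_fac by (intro definable_intros definable_palindrome definable_fac_eq assms)

lemma definable_trapezoidal:
  assumes "definable_fun d i" "definable_fun d n"
  shows "definable d (\<lambda>M e. trapezoidal (fac (dfao_seq k M) (i e) (n e)))"
  unfolding trapezoidal_fac by (intro definable_intros definable_fac_eq assms)

lemma definable_balanced:
  assumes "definable_fun d i" "definable_fun d n"
  shows "definable d (\<lambda>M e. balanced (fac (dfao_seq k M) (i e) (n e)))"
  unfolding balanced_fac by (intro definable_intros assms)

section \<open>Lengths and numbers of factors with a property\<close>

lemma ex_factor_with_iff:
  "(\<exists>w\<in>factors_with P x. Q (length w)) \<longleftrightarrow> (\<exists>n. Q n \<and> (\<exists>i. P x (fac x i n)))"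
proof
  assume "\<exists>w\<in>factors_with P x. Q (length w)"
  then obtain w i where "w = fac x i (length w)" "P x w" "Q (length w)"
    unfolding factors_with_def is_factor_iff by blast
  then show "\<exists>n. Q n \<and> (\<exists>i. P x (fac x i n))"
    by metis
next
  assume "\<exists>n. Q n \<and> (\<exists>i. P x (fac x i n))"
  then obtain n i where "Q n" "P x (fac x i n)"
    by blast
  then show "\<exists>w\<in>factors_with P x. Q (length w)"
    unfolding factors_with_def is_factor_iff by (intro bexI[of _ "fac x i n"]) auto
qed

text \<open>Start and length are arbitrary terms, so that the property may be used below further
  quantifiers. This is all that the conclusions need to know about it.\<close>

definition definable_property :: "((nat \<Rightarrow> nat) \<Rightarrow> nat list \<Rightarrow> bool) \<Rightarrow> bool" where
  "definable_property P \<longleftrightarrow> (\<forall>d i n. definable_fun d i \<longrightarrow> definable_fun d n \<longrightarrow>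
     definable d (\<lambda>M e. P (dfao_seq k M) (fac (dfao_seq k M) (i e) (n e))))"

lemma definable_property_cases:
  assumes "P \<in> {\<lambda>_. closed_word, \<lambda>_. palindrome, maximal_palindrome, \<lambda>_. privileged,
                \<lambda>_. rich, \<lambda>_. trapezoidal, \<lambda>_. balanced}"
  shows "definable_property P"
  using assms unfolding definable_property_def
  by (elim insertE emptyE) (simp_all add: definable_closed definable_palindrome
      definable_maximal_palindrome definable_privileged definable_rich definable_trapezoidal
      definable_balanced)

lemma definable_lengths:
  assumes "definable_property P" "definable_fun d n"
  shows "definable d (\<lambda>M e. \<exists>i. P (dfao_seq k M) (fac (dfao_seq k M) i (n e)))"
  using assms(1)[unfolded definable_property_def, rule_format,
      of "Suc d" hd "\<lambda>e. n (tl e)"]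
  by (intro definable_ex) (simp add: definable_fun_hd definable_fun_tl[OF assms(2)])

lemma finite_range_dfao_seq: "is_dfao k M \<Longrightarrow> finite (range (dfao_seq k M))"
  by (rule finite_subset[of _ "out M ` {..<num_states M}"])
    (auto simp: dfao_seq_state state_less)

lemma definable_few_residuals:
  "definable d R \<Longrightarrow> \<exists>T. \<forall>M. is_dfao k M \<longrightarrow> few_residuals d (T (num_states M)) (R M)"
  unfolding definable_def by blast

lemma automatic_lengths:
  assumes P: "definable_property P" and x: "automatic k x"
  shows "automatic k (\<lambda>n. if \<exists>w\<in>factors_with P x. length w = n then 1 else 0 :: nat)"
proof -
  obtain M where M: "is_dfao k M" "x = dfao_seq k M"
    using x unfolding automatic_def by blast
  obtain N where "few_residuals 1 N (\<lambda>e. \<exists>i. P x (fac x i (hd e)))"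
    using definable_few_residuals[OF definable_lengths[OF P definable_fun_hd[of 0]]] M by auto
  moreover have "(\<exists>w\<in>factors_with P x. length w = n) \<longleftrightarrow> (\<exists>i. P x (fac x i n))" for n
    using ex_factor_with_iff[of P x "\<lambda>l. l = n"] by simp
  ultimately show ?thesis
    using automatic_of_few_residuals by fastforce
qed

text \<open>Each factor is counted at the position of its first occurrence.\<close>

lemma regular_count:
  assumes P: "definable_property P" and x: "automatic k x"
  shows "regular k (\<lambda>n. int (card {w \<in> factors_with P x. length w = n}))"
proof -
  obtain M where M: "is_dfao k M" "x = dfao_seq k M"
    using x unfolding automatic_def by blast
  let ?R = "\<lambda>x e. P x (fac x (hd (tl e)) (hd e)) \<and>
    (\<forall>j. j < hd (tl e) \<longrightarrow> fac x j (hd e) \<noteq> fac x (hd (tl e)) (hd e))"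
  have "definable 2 (\<lambda>M e. ?R (dfao_seq k M) e)"
    unfolding numeral_2_eq_2
    by (intro definable_intros definable_fac_eq P[unfolded definable_property_def, rule_format])
  from definable_few_residuals[OF this] obtain N where N: "few_residuals 2 N (?R x)"
    using M by blast
  have bij: "bij_betw (\<lambda>i. fac x i n) {i. ?R x [n, i]} {w \<in> factors_with P x. length w = n}" for n
    unfolding bij_betw_def
  proof
    show "inj_on (\<lambda>i. fac x i n) {i. ?R x [n, i]}"
    proof (rule inj_onI)
      fix i j assume "i \<in> {i. ?R x [n, i]}" "j \<in> {i. ?R x [n, i]}" "fac x i n = fac x j n"
      then show "i = j"
        by (cases i j rule: linorder_cases) auto
    qed
    show "(\<lambda>i. fac x i n) ` {i. ?R x [n, i]} = {w \<in> factors_with P x. length w = n}"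
    proof
      show "(\<lambda>i. fac x i n) ` {i. ?R x [n, i]} \<subseteq> {w \<in> factors_with P x. length w = n}"
        by (auto simp: factors_with_def is_factor_iff)
      show "{w \<in> factors_with P x. length w = n} \<subseteq> (\<lambda>i. fac x i n) ` {i. ?R x [n, i]}"
      proof
        fix w assume "w \<in> {w \<in> factors_with P x. length w = n}"
        then have w: "P x w" "\<exists>i. fac x i n = w"
          unfolding factors_with_def is_factor_iff by (auto, metis)
        define i where "i = (LEAST i. fac x i n = w)"
        have "fac x i n = w"
          unfolding i_def by (rule LeastI_ex[OF w(2)])
        moreover have "fac x j n \<noteq> w" if "j < i" for j
          using that not_less_Least unfolding i_def by blast
        ultimately show "w \<in> (\<lambda>i. fac x i n) ` {i. ?R x [n, i]}"
          using w(1) by (intro image_eqI[of _ _ i]) auto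
      qed
    qed
  qed
  have "{w \<in> factors_with P x. length w = n} \<subseteq> {w. set w \<subseteq> range x \<and> length w = n}" for n
    by (auto simp: factors_with_def is_factor_def)
  then have "finite {w \<in> factors_with P x. length w = n}" for n
    using finite_subset finite_lists_length_eq[OF finite_range_dfao_seq[OF M(1)]] unfolding M(2) by blast
  then have "finite {i. ?R x [n, i]}" for n
    using bij_betw_finite[OF bij] by blast
  from regular_of_few_residuals[OF N this] show ?thesis
    unfolding bij_betw_same_card[OF bij] .
qed

section \<open>Arbitrarily long factors and uniform bounds\<close>

lemma arbitrarily_long_iff:
  "arbitrarily_long (factors_with P x) \<longleftrightarrow> (\<forall>N. \<exists>n. N \<le> n \<and> (\<exists>i. P x (fac x i n)))"
  unfolding arbitrarily_long_def ex_factor_with_iff[where Q = "\<lambda>n. _ \<le> n"] ..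

lemma decidable_arbitrarily_long:
  assumes P: "definable_property P"
  shows "decidable (dfao_code k) {M. is_dfao k M} (\<lambda>M. arbitrarily_long (factors_with P (dfao_seq k M)))"
proof -
  have "definable 0 (\<lambda>M e. \<forall>N. \<exists>n. N \<le> n \<and> (\<exists>i. P (dfao_seq k M) (fac (dfao_seq k M) i n)))"
    by (intro definable_all definable_ex definable_conj definable_le definable_lengths[OF P]
        definable_fun_hd definable_fun_tl)
  then show ?thesis
  proof (rule definableE)
    fix f
    assume f: "computable (Suc 0) f"
      "\<And>M e. is_dfao k M \<Longrightarrow> length e = 0 \<Longrightarrow> f (dfao_code k M # e) =
        of_bool (\<forall>N. \<exists>n. N \<le> n \<and> (\<exists>i. P (dfao_seq k M) (fac (dfao_seq k M) i n)))"
    obtain g where g: "recursive 1 g" "\<And>xs. length xs = 1 \<Longrightarrow> f xs = g xs"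
      using f(1) unfolding computable_def by auto
    have "g [dfao_code k M] = (if arbitrarily_long (factors_with P (dfao_seq k M)) then 1 else 0)"
      if "is_dfao k M" for M
      using f(2)[OF that, of "[]"] g(2)[of "[dfao_code k M]"]
      unfolding arbitrarily_long_iff of_bool_def by simp
    then show ?thesis
      unfolding decidable_def using g(1) by blast
  qed
qed

text \<open>The case of \<open>bounded_witness\<close> without parameters. The bound inherits from
  \<open>T\<close> that it depends on the DFAO only through its number of states.\<close>

lemma definable_witness_bound:
  assumes "definable 1 R"
  shows "\<exists>B. \<forall>M. is_dfao k M \<longrightarrow> (\<exists>n. R M [n]) \<longrightarrow> (\<exists>n\<le>B (num_states M). R M [n])"
proof -
  obtain T where T: "\<And>M. is_dfao k M \<Longrightarrow> few_residuals 1 (T (num_states M)) (R M)"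
    using definable_few_residuals[OF assms] by blast
  have "\<exists>n\<le>k ^ T (num_states M). R M [n]" if "is_dfao k M" "R M [n]" for M n
    using bounded_witness[of 0 "T (num_states M)" "R M" "[]" n] T[OF that(1)] that(2)
    by (auto intro: less_imp_le)
  then show ?thesis
    by (intro exI[of _ "\<lambda>n. k ^ T n"]) blast
qed

lemma shortest_factor_bound:
  assumes P: "definable_property P"
  shows "\<exists>B. \<forall>M. is_dfao k M \<longrightarrow> factors_with P (dfao_seq k M) \<noteq> {} \<longrightarrow>
    (\<exists>w\<in>factors_with P (dfao_seq k M). length w \<le> B (num_states M))"
proof -
  have "definable 1 (\<lambda>M e. \<exists>i. P (dfao_seq k M) (fac (dfao_seq k M) i (hd e)))"
    using definable_lengths[OF P definable_fun_hd[of 0]] by simp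
  from definable_witness_bound[OF this] obtain B where
    B: "\<And>M. is_dfao k M \<Longrightarrow> \<exists>n i. P (dfao_seq k M) (fac (dfao_seq k M) i n) \<Longrightarrow>
      \<exists>n\<le>B (num_states M). \<exists>i. P (dfao_seq k M) (fac (dfao_seq k M) i n)"
    by auto
  show ?thesis
  proof (intro exI allI impI)
    fix M assume M: "is_dfao k M" "factors_with P (dfao_seq k M) \<noteq> {}"
    then show "\<exists>w\<in>factors_with P (dfao_seq k M). length w \<le> B (num_states M)"
      using B[OF M(1)] ex_factor_with_iff[of P "dfao_seq k M" "\<lambda>_. True"]
      unfolding ex_factor_with_iff[of P _ "\<lambda>n. n \<le> B (num_states M)"] by auto
  qed
qed

text \<open>
  The length of a longest factor with the property is itself definable, so it is bounded as
  soon as it exists.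
\<close>

lemma longest_factor_bound:
  assumes P: "definable_property P"
  shows "\<exists>B. \<forall>M. is_dfao k M \<longrightarrow>
    (\<exists>w\<in>factors_with P (dfao_seq k M). length w \<ge> B (num_states M)) \<longrightarrow>
    arbitrarily_long (factors_with P (dfao_seq k M))"
proof -
  define L where "L M n \<longleftrightarrow> (\<exists>i. P (dfao_seq k M) (fac (dfao_seq k M) i n))" for M n
  have "definable 1 (\<lambda>M e. L M (hd e) \<and> (\<forall>n. hd e < n \<longrightarrow> \<not> L M n))"
    unfolding L_def One_nat_def
    by (intro definable_all definable_conj definable_imp definable_neg definable_less
        definable_lengths[OF P] definable_fun_hd definable_fun_tl)
  from definable_witness_bound[OF this] obtain B where
    B: "\<And>M. is_dfao k M \<Longrightarrow> \<exists>n. L M n \<and> (\<forall>n'. n < n' \<longrightarrow> \<not> L M n') \<Longrightarrow>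
      \<exists>n\<le>B (num_states M). L M n \<and> (\<forall>n'. n < n' \<longrightarrow> \<not> L M n')"
    by auto
  show ?thesis
  \<comment> \<open>A longest factor may have length exactly \<open>B n\<close>; only a factor
    longer than that shows that no longest one exists.\<close>
  proof (intro exI[of _ "\<lambda>n. Suc (B n)"] allI impI)
    fix M assume M: "is_dfao k M" and "\<exists>w\<in>factors_with P (dfao_seq k M). length w \<ge> Suc (B (num_states M))"
    then obtain l where l: "l \<ge> Suc (B (num_states M))" "L M l"
      unfolding ex_factor_with_iff[of P _ "\<lambda>n. Suc (B (num_states M)) \<le> n"] L_def by blast
    show "arbitrarily_long (factors_with P (dfao_seq k M))"
      unfolding arbitrarily_long_iff L_def[symmetric]
    proof (rule ccontr)
      assume "\<not> (\<forall>N. \<exists>n. N \<le> n \<and> L M n)"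
      then obtain N where N: "\<And>n. L M n \<Longrightarrow> n \<le> N"
        by (meson nat_le_linear)
      define m where "m = (GREATEST n. L M n)"
      have "L M m" "\<And>n. L M n \<Longrightarrow> n \<le> m"
        unfolding m_def using N l(2) by (auto intro: GreatestI_nat Greatest_le_nat)
      then have "\<exists>n. L M n \<and> (\<forall>n'. n < n' \<longrightarrow> \<not> L M n')"
        using not_le by blast
      from B[OF M this] l show False
        by (meson Suc_le_lessD le_less_trans)
    qed
  qed
qed

end

theorem theorem13:
  fixes P :: "(nat \<Rightarrow> nat) \<Rightarrow> nat list \<Rightarrow> bool"
  assumes "P \<in> {\<lambda>_. closed_word, \<lambda>_. palindrome, maximal_palindrome, \<lambda>_. privileged,
                \<lambda>_. rich, \<lambda>_. trapezoidal, \<lambda>_. balanced}"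
  shows
    "(\<forall>k\<ge>2. \<forall>x. automatic k x \<longrightarrow>
        automatic k (\<lambda>n. if \<exists>w\<in>factors_with P x. length w = n then 1 else 0 :: nat))
   \<and> (\<forall>k\<ge>2. \<forall>x. automatic k x \<longrightarrow>
        regular k (\<lambda>n. int (card {w \<in> factors_with P x. length w = n})))
   \<and> (\<forall>k\<ge>2. decidable (dfao_code k) {M. is_dfao k M}
        (\<lambda>M. arbitrarily_long (factors_with P (dfao_seq k M))))
   \<and> (\<exists>g :: nat \<Rightarrow> nat \<Rightarrow> nat \<Rightarrow> nat. \<forall>k\<ge>2. \<forall>l n M A.
        is_dfao k M \<and> num_states M = n \<and>
        finite A \<and> card A = l \<and> range (dfao_seq k M) \<subseteq> A \<and>
        factors_with P (dfao_seq k M) \<noteq> {} \<longrightarrow>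
        (\<exists>w\<in>factors_with P (dfao_seq k M). length w \<le> g k l n))
   \<and> (\<exists>h :: nat \<Rightarrow> nat \<Rightarrow> nat \<Rightarrow> nat. \<forall>k\<ge>2. \<forall>l n M A.
        is_dfao k M \<and> num_states M = n \<and>
        finite A \<and> card A = l \<and> range (dfao_seq k M) \<subseteq> A \<and>
        (\<exists>w\<in>factors_with P (dfao_seq k M). length w \<ge> h k l n) \<longrightarrow>
        arbitrarily_long (factors_with P (dfao_seq k M)))"
proof (intro conjI allI impI)
  have P: "numeration.definable_property k P" if "k \<ge> 2" for k
    using numeration.definable_property_cases[OF numeration.intro[OF that] assms] .
  show "automatic k (\<lambda>n. if \<exists>w\<in>factors_with P x. length w = n then 1 else 0 :: nat)"
    if "k \<ge> 2" "automatic k x" for k x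
    using numeration.automatic_lengths[OF numeration.intro P] that by blast
  show "regular k (\<lambda>n. int (card {w \<in> factors_with P x. length w = n}))"
    if "k \<ge> 2" "automatic k x" for k x
    using numeration.regular_count[OF numeration.intro P] that by blast
  show "decidable (dfao_code k) {M. is_dfao k M} (\<lambda>M. arbitrarily_long (factors_with P (dfao_seq k M)))"
    if "k \<ge> 2" for k
    using numeration.decidable_arbitrarily_long[OF numeration.intro P] that by blast
  obtain G where G: "\<And>k M. k \<ge> 2 \<Longrightarrow> is_dfao k M \<Longrightarrow> factors_with P (dfao_seq k M) \<noteq> {} \<Longrightarrow>
      \<exists>w\<in>factors_with P (dfao_seq k M). length w \<le> G k (num_states M)"
    using numeration.shortest_factor_bound[OF numeration.intro P] by metis
  show "\<exists>g :: nat \<Rightarrow> nat \<Rightarrow> nat \<Rightarrow> nat. \<forall>k\<ge>2. \<forall>l n M A.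
        is_dfao k M \<and> num_states M = n \<and>
        finite A \<and> card A = l \<and> range (dfao_seq k M) \<subseteq> A \<and>
        factors_with P (dfao_seq k M) \<noteq> {} \<longrightarrow>
        (\<exists>w\<in>factors_with P (dfao_seq k M). length w \<le> g k l n)"
    by (rule exI[of _ "\<lambda>k l n. G k n"]) (use G in blast)
  obtain H where H: "\<And>k M. k \<ge> 2 \<Longrightarrow> is_dfao k M \<Longrightarrow>
      \<exists>w\<in>factors_with P (dfao_seq k M). length w \<ge> H k (num_states M) \<Longrightarrow>
      arbitrarily_long (factors_with P (dfao_seq k M))"
    using numeration.longest_factor_bound[OF numeration.intro P] by metis
  show "\<exists>h :: nat \<Rightarrow> nat \<Rightarrow> nat \<Rightarrow> nat. \<forall>k\<ge>2. \<forall>l n M A.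
        is_dfao k M \<and> num_states M = n \<and>
        finite A \<and> card A = l \<and> range (dfao_seq k M) \<subseteq> A \<and>
        (\<exists>w\<in>factors_with P (dfao_seq k M). length w \<ge> h k l n) \<longrightarrow>
        arbitrarily_long (factors_with P (dfao_seq k M))"
    by (rule exI[of _ "\<lambda>k l n. H k n"]) (use H in blast)
qed

end
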